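(* Let $p$ be prime, and let $\theta=\varprojlim\theta_\alpha$ be a profinite substitution that generates an inverse family of two-sided shifts $\{(X_{u_\alpha},\sigma):\alpha\ge0\}$. Suppose that each $\theta_\alpha$ is length-$p$ and primitive. Then $\theta$ is recognizable: for any $y\in X_u$, where $X_u=\varprojlim X_{u_\alpha}$ is the two-sided profinite shift, there is a unique way to write $y=\sigma^k(\theta(x))$ with $x\in X_u$ and $0\le k<|\theta(x(0))|=p$.
   Context: $\Sigma_p=\{0,\dots,p-1\}$. An inverse family of finite automata is a sequence $(\mathcal M_\alpha)_{\alpha\ge0}=(\mathcal S_\alpha,\Sigma_p,\delta_\alpha,\overline s_\alpha,\mathbb Z/(p^\alpha\mathbb Z),\tau_\alpha)_{\alpha\ge0}$, where $\mathcal S_\alpha$ is a finite set of states, $\overline s_\alpha\in\mathcal S_\alpha$ the initial state, $\delta_\alpha:\mathcal S_\alpha\times\Sigma_p\to\mathcal S_\alpha$ the transition function, $\tau_\alpha:\mathcal S_\alpha\to\mathbb Z/(p^\alpha\mathbb Z)$ the output function, together with maps $\psi_{\alpha,\beta}:\mathcal S_\beta\to\mathcal S_\alpha$ ($0\le\alpha\le\beta$) satisfying $\psi_{\alpha,\beta}(\overline s_\beta)=\overline s_\alpha$, $\psi_{\alpha,\beta}(\delta_\beta(s,i))=\delta_\alpha(\psi_{\alpha,\beta}(s),i)$, $\tau_\beta(s)\bmod p^\alpha=\tau_\alpha(\psi_{\alpha,\beta}(s))$, and $\psi_{\alpha,\gamma}=\psi_{\alpha,\beta}\circ\psi_{\beta,\gamma}$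 for $\alpha\le\beta\le\gamma$. A substitution on an alphabet $\mathcal A$ (not necessarily finite) is a map $\theta:\mathcal A\to\mathcal A^*$, extended to sequences by concatenation; it is length-$p$ if $|\theta(a)|=p$ for all $a\in\mathcal A$. The automaton $\mathcal M_\alpha$ defines a length-$p$ substitution $\theta_\alpha$ by $\theta_\alpha(s)=\delta_\alpha(s,0)\delta_\alpha(s,1)\cdots\delta_\alpha(s,p-1)$ for $s\in\mathcal S_\alpha$; if $\delta_\alpha(\overline s_\alpha,0)\ne\overline s_\alpha$, one introduces a new letter $\overline s_\alpha'$ and lets $\theta_\alpha(\overline s_\alpha')=\overline s_\alpha'\,\delta_\alpha(\overline s_\alpha,1)\cdots\delta_\alpha(\overline s_\alpha,p-1)$. The sequence $u_\alpha$ is a fixed point of $\theta_\alpha$, the one corresponding to $\mathcal M_\alpha$. Let $\mathcal S=\varprojlim\mathcal S_\alpha=\{(s_\alpha)_\alpha\in\prod_\alpha\mathcal S_\alpha:\psi_{\alpha,\beta}(s_\beta)=s_\alpha\text{ for all }\alpha\le\beta\}$. The profinite substitution $\theta=\varprojlim\theta_\alpha$ is the length-$p$ substitution $\theta:\mathcal S\to\mathcal S^p$ whose $i$-th letter is $\theta(s)_i=\varprojlim\theta_\alpha(s_\alpha)_i$ for $s=\varprojlim s_\alpha$ and $0\le i\le p-1$; it has the fixed point $u=\varprojlim u_\alpha$. A substitution $\theta$ on a finite alphabet $\mathcal A$ is primitive if there is some $k\in\mathbb N$ such that for all $a,a'\in\mathcal A$ the word $\theta^k(a)$ contains $a'$.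 The two-sided shift $X_{u_\alpha}$ generated by $\theta_\alpha$ is the set of bi-infinite sequences all of whose subwords are subwords of $\theta_\alpha^n(a)$ for some $n\ge1$ and some letter $a$; equivalently, it is the natural extension of the one-sided shift $\tilde X_{u_\alpha}$ (the closure of the orbit of $u_\alpha$ under the shift), i.e. the set of sequences $(x_j)_{j\ge0}$ with $x_j\in\tilde X_{u_\alpha}$ and $\sigma(x_{j+1})=x_j$. Here $\sigma$ is the left shift $(\sigma x)(n)=x(n+1)$. The maps $\psi_{\alpha,\beta}$, applied termwise, make the two-sided shifts an inverse family, and $X_u=\varprojlim X_{u_\alpha}$ is the set of families $(x_\alpha)_{\alpha\ge 0}$, $x_\alpha\in X_{u_\alpha}$, with $\psi_{\alpha,\beta}(x_\beta)=x_\alpha$ for all $\alpha\le\beta$, regarded as bi-infinite sequences over $\mathcal S$. Substitutions act on bi-infinite sequences by concatenation, the word $\theta(x(0))$ occupying positions $0,\dots,p-1$ of $\theta(x)$.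
   Formalization: Adds the hypothesis that for every N some level α has all periods of u_α divisible by p^N (e.g. some u_α aperiodic); without it the claim fails, e.g. for one state at every level, where k is not unique. *)

theory Defs
  imports Complex_Main "HOL-Computational_Algebra.Primes" "HOL-Library.Sublist"
begin

section \<open>Inverse families of automata\<close>

text \<open>Automata reading the digits \<open>0, \<dots>, p - 1\<close>; the residues modulo \<open>m\<close> are
  represented by \<open>{0..<m}\<close>. One state type carries the states of all the automata of a family,
  each automaton having its own finite set of states in it; this is no restriction, since finite
  sets embed into a common type.\<close>

record 'q automaton =
  states :: "'q set"
  trans :: "'q \<Rightarrow> nat \<Rightarrow> 'q"
  init :: 'q
  tau :: "'q \<Rightarrow> nat"

definition automaton_mod :: "nat \<Rightarrow> nat \<Rightarrow> 'q automaton \<Rightarrow> bool" where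
  "automaton_mod p m M \<longleftrightarrow>
     finite (states M) \<and> init M \<in> states M \<and>
     (\<forall>s\<in>states M. \<forall>i<p. trans M s i \<in> states M) \<and>
     (\<forall>s\<in>states M. tau M s < m)"

definition inverse_family :: "nat \<Rightarrow> (nat \<Rightarrow> 'q automaton) \<Rightarrow> (nat \<Rightarrow> nat \<Rightarrow> 'q \<Rightarrow> 'q) \<Rightarrow> bool" where
  "inverse_family p M \<psi> \<longleftrightarrow>
     (\<forall>\<alpha>. automaton_mod p (p ^ \<alpha>) (M \<alpha>)) \<and>
     (\<forall>\<alpha> \<beta>. \<alpha> \<le> \<beta> \<longrightarrow>
        \<psi> \<alpha> \<beta> ` states (M \<beta>) \<subseteq> states (M \<alpha>) \<and>
        \<psi> \<alpha> \<beta> (init (M \<beta>)) = init (M \<alpha>) \<and>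
        (\<forall>s\<in>states (M \<beta>). \<forall>i<p. \<psi> \<alpha> \<beta> (trans (M \<beta>) s i) = trans (M \<alpha>) (\<psi> \<alpha> \<beta> s) i) \<and>
        (\<forall>s\<in>states (M \<beta>). tau (M \<beta>) s mod p ^ \<alpha> = tau (M \<alpha>) (\<psi> \<alpha> \<beta> s))) \<and>
     (\<forall>\<alpha> \<beta> \<gamma>. \<alpha> \<le> \<beta> \<longrightarrow> \<beta> \<le> \<gamma> \<longrightarrow>
        (\<forall>s\<in>states (M \<gamma>). \<psi> \<alpha> \<gamma> s = \<psi> \<alpha> \<beta> (\<psi> \<beta> \<gamma> s)))"


section \<open>Substitutions and bi-infinite sequences\<close>

definition apply_word :: "('a \<Rightarrow> 'a list) \<Rightarrow> 'a list \<Rightarrow> 'a list" where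
  "apply_word \<theta> w = concat (map \<theta> w)"

definition const_length :: "nat \<Rightarrow> 'a set \<Rightarrow> ('a \<Rightarrow> 'a list) \<Rightarrow> bool" where
  "const_length p A \<theta> \<longleftrightarrow> (\<forall>a\<in>A. length (\<theta> a) = p)"

definition primitive :: "'a set \<Rightarrow> ('a \<Rightarrow> 'a list) \<Rightarrow> bool" where
  "primitive A \<theta> \<longleftrightarrow> (\<exists>k. \<forall>a\<in>A. \<forall>a'\<in>A. a' \<in> set ((apply_word \<theta> ^^ k) [a]))"

text \<open>If \<open>\<theta> a\<close> begins with \<open>a\<close>, each word \<open>\<theta>\<^sup>n(a)\<close> is a prefix of the next one. When \<open>\<theta>\<close> has
  constant length \<open>p \<ge> 2\<close>, the \<open>n\<close>-th of them has length \<open>p ^ n > n\<close>, so it determines the letter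
  at position \<open>n\<close> of the fixed point beginning with \<open>a\<close>.\<close>

definition fixed_point :: "('a \<Rightarrow> 'a list) \<Rightarrow> 'a \<Rightarrow> nat \<Rightarrow> 'a" where
  "fixed_point \<theta> a n = ((apply_word \<theta> ^^ n) [a]) ! n"

definition is_period :: "(nat \<Rightarrow> 'a) \<Rightarrow> nat \<Rightarrow> bool" where
  "is_period v q \<longleftrightarrow> q > 0 \<and> (\<forall>n. v (n + q) = v n)"

definition shift :: "(int \<Rightarrow> 'a) \<Rightarrow> int \<Rightarrow> 'a" where
  "shift x n = x (n + 1)"

text \<open>Concatenation of the words \<open>\<theta> (x j)\<close>, all of length \<open>p\<close>, with \<open>\<theta> (x 0)\<close> at the positions
  \<open>0, \<dots>, p - 1\<close>.\<close>

definition apply_biinf :: "nat \<Rightarrow> ('a \<Rightarrow> 'a list) \<Rightarrow> (int \<Rightarrow> 'a) \<Rightarrow> int \<Rightarrow> 'a" where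
  "apply_biinf p \<theta> x n = \<theta> (x (n div int p)) ! nat (n mod int p)"

definition two_sided_shift :: "'a set \<Rightarrow> ('a \<Rightarrow> 'a list) \<Rightarrow> (int \<Rightarrow> 'a) set" where
  "two_sided_shift A \<theta> =
     {x. \<forall>i j. \<exists>n\<ge>1. \<exists>a\<in>A. sublist (map x [i..j]) ((apply_word \<theta> ^^ n) [a])}"

definition recognizable :: "nat \<Rightarrow> (int \<Rightarrow> 'a) set \<Rightarrow> ('a \<Rightarrow> 'a list) \<Rightarrow> bool" where
  "recognizable p X \<theta> \<longleftrightarrow>
     (\<forall>y\<in>X. \<exists>!(x, k). x \<in> X \<and> k < length (\<theta> (x 0)) \<and> y = (shift ^^ k) (apply_biinf p \<theta> x))"


section \<open>The substitution of an automaton\<close>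

text \<open>\<open>Fresh\<close> is the additional letter that replaces the initial state when the latter is not fixed
  by reading \<open>0\<close>; otherwise it does not belong to the alphabet.\<close>

datatype 'q letter = State 'q | Fresh

definition start_letter :: "'q automaton \<Rightarrow> 'q letter" where
  "start_letter M = (if trans M (init M) 0 = init M then State (init M) else Fresh)"

definition alphabet :: "'q automaton \<Rightarrow> 'q letter set" where
  "alphabet M = insert (start_letter M) (State ` states M)"

fun aut_subst :: "nat \<Rightarrow> 'q automaton \<Rightarrow> 'q letter \<Rightarrow> 'q letter list" where
  "aut_subst p M (State s) = map (\<lambda>i. State (trans M s i)) [0..<p]"
| "aut_subst p M Fresh = Fresh # map (\<lambda>i. State (trans M (init M) i)) [1..<p]"

definition aut_fixed_point :: "nat \<Rightarrow> 'q automaton \<Rightarrow> nat \<Rightarrow> 'q letter" where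
  "aut_fixed_point p M = fixed_point (aut_subst p M) (start_letter M)"

definition aut_shift :: "nat \<Rightarrow> 'q automaton \<Rightarrow> (int \<Rightarrow> 'q letter) set" where
  "aut_shift p M = two_sided_shift (alphabet M) (aut_subst p M)"


section \<open>Inverse limits\<close>

text \<open>The map \<open>\<psi> \<alpha> \<beta>\<close> on letters. The additional letter goes to the letter with which the fixed
  point at level \<open>\<alpha>\<close> begins, so that the fixed point at level \<open>\<beta>\<close> is mapped to the one at level
  \<open>\<alpha>\<close>.\<close>

fun letter_map ::
    "(nat \<Rightarrow> 'q automaton) \<Rightarrow> (nat \<Rightarrow> nat \<Rightarrow> 'q \<Rightarrow> 'q) \<Rightarrow> nat \<Rightarrow> nat \<Rightarrow> 'q letter \<Rightarrow> 'q letter" where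
  "letter_map M \<psi> \<alpha> \<beta> (State s) = State (\<psi> \<alpha> \<beta> s)"
| "letter_map M \<psi> \<alpha> \<beta> Fresh = start_letter (M \<alpha>)"

text \<open>A letter of the profinite alphabet is a compatible family \<open>s :: nat \<Rightarrow> 'q letter\<close>. The
  profinite substitution acts on such families level by level.\<close>

definition profinite_subst ::
    "nat \<Rightarrow> (nat \<Rightarrow> 'q automaton) \<Rightarrow> (nat \<Rightarrow> 'q letter) \<Rightarrow> (nat \<Rightarrow> 'q letter) list" where
  "profinite_subst p M s = map (\<lambda>i \<alpha>. aut_subst p (M \<alpha>) (s \<alpha>) ! i) [0..<p]"

text \<open>The families \<open>(x\<^sub>\<alpha>)\<close> of the inverse limit of the two-sided shifts, regarded as
  bi-infinite sequences \<open>x\<close> of families of letters, with \<open>x\<^sub>\<alpha>\<close> being \<open>\<lambda>n. x n \<alpha>\<close>.\<close>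

definition profinite_shift ::
    "nat \<Rightarrow> (nat \<Rightarrow> 'q automaton) \<Rightarrow> (nat \<Rightarrow> nat \<Rightarrow> 'q \<Rightarrow> 'q) \<Rightarrow> (int \<Rightarrow> nat \<Rightarrow> 'q letter) set" where
  "profinite_shift p M \<psi> =
     {x. (\<forall>\<alpha>. (\<lambda>n. x n \<alpha>) \<in> aut_shift p (M \<alpha>)) \<and>
         (\<forall>\<alpha> \<beta>. \<alpha> \<le> \<beta> \<longrightarrow> (\<forall>n. letter_map M \<psi> \<alpha> \<beta> (x n \<beta>) = x n \<alpha>))}"

text \<open>Without a non-degeneracy condition recognizability can fail: with a single state at every
  level, for example, \<open>y = \<sigma>\<^sup>k(\<theta>(y))\<close> holds for every \<open>k < p\<close>. In general it fails whenever
  there is an \<open>N\<close> such that every \<open>u\<^sub>\<alpha>\<close> has a period not divisible by \<open>p\<^sup>N\<close>. The following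
  condition excludes exactly these cases. It holds if some \<open>u\<^sub>\<alpha>\<close> is not periodic, and also for
  families such as \<open>S\<^sub>\<alpha> = \<int>/p\<^sup>\<alpha>\<int>\<close>, \<open>\<delta>\<^sub>\<alpha>(s, i) = p s + i\<close>, where every \<open>u\<^sub>\<alpha>\<close> is periodic.\<close>

definition unbounded_p_periods :: "nat \<Rightarrow> (nat \<Rightarrow> 'q automaton) \<Rightarrow> bool" where
  "unbounded_p_periods p M \<longleftrightarrow>
     (\<forall>N. \<exists>\<alpha>. \<forall>q. is_period (aut_fixed_point p (M \<alpha>)) q \<longrightarrow> p ^ N dvd q)"

end

(* Primitivity excludes the additional letter. At one level, let X be the shift, T n the map
   given by theta^n, and suppose that p^n divides all periods of u. Then T n z = sigma^k (T n z')
   forces p^n to divide k: otherwise minimality gives T n X = sigma^(p^(n-1)) (T n X), hence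
   T (n-1) X = T m X for all m >= n - 1, so the number of words of length p^m is bounded, X
   consists of shifts of one periodic point, and k plus a multiple of p^n is a period.
   Thus the cutting points of every order are unique at all sufficiently high levels. This also
   makes theta injective: T 1 x = T 1 x' at a high level implies that x and x' have the same image
   at a fixed level alpha, because the relation theta^N(a) = theta^N(b) on the letters of level
   alpha stabilizes as N grows. Preimages exist at every level by compactness, and the images at
   level alpha of preimages taken at high levels are independent of the choice, hence
   compatible. *)

theory Submission
  imports Defs "HOL-Library.FuncSet" "HOL-Library.Infinite_Set"
begin

section \<open>Powers of a substitution of constant length\<close>

definition power_letter :: "('a \<Rightarrow> 'a list) \<Rightarrow> nat \<Rightarrow> 'a \<Rightarrow> nat \<Rightarrow> 'a" where
  "power_letter \<theta> n a i = ((apply_word \<theta> ^^ n) [a]) ! i"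

text \<open>Defined in one step instead of by iterating \<open>apply_biinf\<close>, so that a single
  division by the block length \<open>p ^ n\<close> finds each letter. The link to
  \<open>apply_biinf\<close> is \<open>power_biinf_1\<close>, and \<open>T_add\<close> gives the
  composition of powers.\<close>

definition power_biinf :: "nat \<Rightarrow> ('a \<Rightarrow> 'a list) \<Rightarrow> nat \<Rightarrow> (int \<Rightarrow> 'a) \<Rightarrow> int \<Rightarrow> 'a" where
  "power_biinf p \<theta> n x j = power_letter \<theta> n (x (j div int (p ^ n))) (nat (j mod int (p ^ n)))"

section \<open>Translations by arbitrary integers\<close>

definition shift_by :: "int \<Rightarrow> (int \<Rightarrow> 'a) \<Rightarrow> int \<Rightarrow> 'a" where
  "shift_by r x j = x (j + r)"

lemma shift_by_shift_by [simp]: "shift_by r (shift_by s x) = shift_by (r + s) x"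
  by (auto simp: shift_by_def fun_eq_iff ac_simps)

lemma shift_by_0 [simp]: "shift_by 0 x = x"
  by (auto simp: shift_by_def)

lemma shift_by_eq_iff: "x = shift_by r y \<longleftrightarrow> shift_by (- r) x = y"
  by (metis add.right_inverse add.commute shift_by_0 shift_by_shift_by)

lemma shift_by_eq_shift_by_iff: "shift_by r x = shift_by s y \<longleftrightarrow> x = shift_by (s - r) y"
  unfolding shift_by_eq_iff[of "shift_by r x"] shift_by_eq_iff[of x] by simp

lemma shift_by_multiple:
  assumes "shift_by q x = x" shows "shift_by (l * q) x = x"
proof -
  have nat: "shift_by (int m * q) x = x" for m
  proof (induction m)
    case (Suc m)
    have "shift_by (int (Suc m) * q) x = shift_by (int m * q) (shift_by q x)"
      by (simp add: algebra_simps)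
    then show ?case using assms Suc by simp
  qed simp
  show ?thesis
  proof (cases "l \<ge> 0")
    case True
    then show ?thesis using nat[of "nat l"] by simp
  next
    case False
    then have "shift_by (- (l * q)) x = x" using nat[of "nat (- l)"] by simp
    then show ?thesis using shift_by_eq_iff[of x "l * q" x] by simp
  qed
qed

lemma funpow_shift: "shift ^^ k = shift_by (int k)"
proof (induction k)
  case (Suc k)
  then show ?case
    by (auto simp: fun_eq_iff shift_def shift_by_def ac_simps)
qed (auto simp: fun_eq_iff)

lemma power_biinf_1: "power_biinf p \<theta> 1 x = apply_biinf p \<theta> x"
  by (auto simp: power_biinf_def apply_biinf_def power_letter_def apply_word_def fun_eq_iff)

section \<open>Blocks of equal length and a finite choice principle\<close>

lemma length_concat_const:
  assumes "\<And>w. w \<in> set ws \<Longrightarrow> length w = l"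
  shows "length (concat ws) = l * length ws"
  using assms by (induction ws) auto

lemma nth_concat_const:
  assumes "\<And>w. w \<in> set ws \<Longrightarrow> length w = l" and "i < l * length ws"
  shows "concat ws ! i = ws ! (i div l) ! (i mod l)"
  using assms
proof (induction ws arbitrary: i)
  case (Cons w ws)
  have l: "length w = l"
    using Cons.prems by auto
  show ?case
  proof (cases "i < l")
    case False
    with Cons.prems(2) have "concat ws ! (i - l) = ws ! ((i - l) div l) ! ((i - l) mod l)"
      by (intro Cons.IH) (use Cons.prems in auto)
    moreover have "l > 0" using Cons.prems by (cases l) auto
    ultimately show ?thesis
      using False l by (simp add: nth_append nth_Cons' le_div_geq le_mod_geq)
  qed (use l in \<open>auto simp: nth_append\<close>)
qed auto

text \<open>The block containing a position of the window [-W, W] again has its index in [-W, W].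
  Hence a window of x determines the window of the same radius of its image under any power.\<close>

lemma abs_div_le: "\<bar>j\<bar> \<le> int W \<Longrightarrow> q > 0 \<Longrightarrow> \<bar>j div int q\<bar> \<le> int W"
proof -
  assume j: "\<bar>j\<bar> \<le> int W" and q: "q > 0"
  show ?thesis
  proof (cases "j \<ge> 0")
    case True
    then have "j div int q \<ge> 0" "j div int q \<le> j"
      using q zdiv_mono2[OF True, of 1 "int q"] by (auto simp: pos_imp_zdiv_nonneg_iff)
    then show ?thesis using j by simp
  next
    case False
    then have "j div int q < 0" using q by (simp add: pos_imp_zdiv_neg_iff)
    moreover have "j \<le> j div int q"
    proof -
      have "j * int q \<le> j * 1" using False q by (intro mult_left_mono_neg) auto
      then have "(j * int q) div int q \<le> j div int q" using q by (intro zdiv_mono1) auto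
      then show ?thesis using q by simp
    qed
    ultimately show ?thesis using j by simp
  qed
qed

text \<open>If each \<open>k\<close> failed at some \<open>f k\<close>, then by monotonicity every
  \<open>k\<close> would fail at the maximum of these finitely many thresholds. This makes a choice
  depending on the radius of a window uniform in the radius.\<close>

lemma finite_antimono_choice:
  assumes "finite K" "\<And>W::nat. \<exists>k\<in>K. Q k W"
    and "\<And>k W W'. W \<le> W' \<Longrightarrow> Q k W' \<Longrightarrow> Q k W"
  shows "\<exists>k\<in>K. \<forall>W. Q k W"
proof (rule ccontr)
  assume "\<not> ?thesis"
  then obtain f where f: "\<And>k. k \<in> K \<Longrightarrow> \<not> Q k (f k)" by metis
  obtain k where k: "k \<in> K" "Q k (Max (f ` K))" using assms(2) by blast
  then have "f k \<le> Max (f ` K)" using assms(1) by auto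
  then show False using f[OF k(1)] assms(3)[OF _ k(2)] by blast
qed

lemma dvd_diff_imp_eq:
  assumes "int m dvd int k' - int k" "k < m" "k' < m" shows "k = k'"
proof -
  have "\<bar>int k' - int k\<bar> < \<bar>int m\<bar>" using assms by linarith
  then show ?thesis using dvd_imp_le_int[OF _ assms(1)] by force
qed

section \<open>The two-sided shift of a primitive substitution\<close>

text \<open>The letter \<open>a0\<close> begins its own image and so starts a fixed point. It is
  singled out because the non-degeneracy condition concerns the periods of that fixed point.\<close>

locale primitive_subst =
  fixes p :: nat and A :: "'a set" and \<theta> :: "'a \<Rightarrow> 'a list" and a0 :: 'a
  assumes p: "prime p"
    and finA: "finite A"
    and a0: "a0 \<in> A"
    and closed: "\<And>a. a \<in> A \<Longrightarrow> set (\<theta> a) \<subseteq> A"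
    and len: "const_length p A \<theta>"
    and prim: "primitive A \<theta>"
    and a0_fix: "\<theta> a0 ! 0 = a0"
begin

abbreviation D where "D \<equiv> power_letter \<theta>"
abbreviation T where "T \<equiv> power_biinf p \<theta>"
abbreviation X where "X \<equiv> two_sided_shift A \<theta>"

section \<open>Lengths and letters of the powers of the substitution\<close>

lemma p_gt_1: "p > 1"
  using p prime_gt_1_nat by blast

lemma p_pos [simp]: "p > 0"
  using p_gt_1 by simp

lemma less_p_power: "n < p ^ n"
  using p_gt_1 by (simp add: power_gt_expt)

lemma word_power:
  assumes "set w \<subseteq> A"
  shows "set ((apply_word \<theta> ^^ n) w) \<subseteq> A" "length ((apply_word \<theta> ^^ n) w) = p ^ n * length w"
proof (induction n)
  case (Suc n)
  {
    case 1
    show ?case using Suc closed by (auto simp: apply_word_def)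
  next
    case 2
    have "length v = p" if "v \<in> set (map \<theta> ((apply_word \<theta> ^^ n) w))" for v
      using that Suc(1) len by (auto simp: const_length_def)
    then have "length (apply_word \<theta> ((apply_word \<theta> ^^ n) w)) = p * length ((apply_word \<theta> ^^ n) w)"
      unfolding apply_word_def[of \<theta> "(apply_word \<theta> ^^ n) w"] by (subst length_concat_const[of _ p]) auto
    then show ?case using Suc(2) by simp
  }
qed (use assms in auto)

lemma word_power_singleton:
  assumes "a \<in> A"
  shows "set ((apply_word \<theta> ^^ n) [a]) \<subseteq> A" "length ((apply_word \<theta> ^^ n) [a]) = p ^ n"
  using word_power[of "[a]" n] assms by auto

lemma D_in: "a \<in> A \<Longrightarrow> i < p ^ n \<Longrightarrow> D n a i \<in> A"
  unfolding power_letter_def using word_power_singleton[of a n] nth_mem by fastforce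

lemma D_0 [simp]: "D 0 a 0 = a"
  by (simp add: power_letter_def)

lemma word_power_concat:
  "(apply_word \<theta> ^^ n) w = concat (map (\<lambda>a. (apply_word \<theta> ^^ n) [a]) w)"
proof (induction n)
  case (Suc n)
  have "apply_word \<theta> (concat ws) = concat (map (apply_word \<theta>) ws)" for ws
    by (induction ws) (auto simp: apply_word_def)
  then show ?case
    using Suc by (simp add: o_def)
qed auto

text \<open>The word \<theta>^(m+n)(a) is cut into blocks \<theta>^m(b), one for each letter b of
  \<theta>^n(a). The quotient by p^m selects the block, the remainder the letter in it.\<close>

lemma D_add:
  assumes "a \<in> A" "i < p ^ (m + n)"
  shows "D (m + n) a i = D m (D n a (i div p ^ m)) (i mod p ^ m)"
proof -
  let ?w = "(apply_word \<theta> ^^ n) [a]"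
  have w: "set ?w \<subseteq> A" "length ?w = p ^ n"
    using word_power_singleton assms by auto
  have idiv: "i div p ^ m < p ^ n"
    using assms(2) by (simp add: power_add less_mult_imp_div_less mult.commute)
  have "D (m + n) a i = concat (map (\<lambda>a. (apply_word \<theta> ^^ m) [a]) ?w) ! i"
    by (simp add: power_letter_def funpow_add flip: word_power_concat)
  also have "\<dots> = map (\<lambda>a. (apply_word \<theta> ^^ m) [a]) ?w ! (i div p ^ m) ! (i mod p ^ m)"
    by (rule nth_concat_const)
       (use w assms word_power_singleton(2) in \<open>auto simp: power_add subset_iff\<close>)
  also have "\<dots> = D m (D n a (i div p ^ m)) (i mod p ^ m)"
    using w idiv by (simp add: power_letter_def)
  finally show ?thesis .
qed

lemma D_add_split:
  assumes "a \<in> A" "j < p ^ m" "q < p ^ n"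
  shows "D (m + n) a (q * p ^ m + j) = D m (D n a q) j"
proof -
  have "q * p ^ m + j < (q + 1) * p ^ m" using assms by simp
  also have "\<dots> \<le> p ^ n * p ^ m" using assms by (intro mult_right_mono) auto
  finally have "q * p ^ m + j < p ^ (m + n)" by (simp add: power_add mult.commute)
  then show ?thesis using assms by (subst D_add) auto
qed

lemma D_add_int:
  assumes "a \<in> A" "0 \<le> i" "i < int (p ^ (m + n))"
  shows "D (m + n) a (nat i) = D m (D n a (nat (i div int (p ^ m)))) (nat (i mod int (p ^ m)))"
proof -
  have "nat i < p ^ (m + n)" using assms by (simp add: nat_less_iff)
  then have "D (m + n) a (nat i) = D m (D n a (nat i div p ^ m)) (nat i mod p ^ m)"
    using assms by (intro D_add) auto
  then show ?thesis using assms by (simp add: nat_div_distrib nat_mod_distrib nat_power_eq)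
qed

text \<open>Each \<theta>^n(a0) begins with a0, so \<theta>^(m+n)(a0) begins with
  \<theta>^m(a0).\<close>

lemma D_a0:
  assumes "i < p ^ m" shows "D (m + n) a0 i = D m a0 i"
proof -
  have fix0: "D n a0 0 = a0" for n
  proof (induction n)
    case (Suc n)
    have "D (1 + n) a0 0 = D 1 (D n a0 0) 0"
      using D_add[of a0 0 1 n] a0 by simp
    then show ?case
      using Suc a0_fix len a0 by (simp add: power_letter_def apply_word_def)
  qed simp
  show ?thesis using D_add_split[of a0 i m 0 n] assms a0 fix0 by simp
qed

section \<open>Central windows of the points of the shift\<close>

definition admissible :: "(int \<Rightarrow> 'a) \<Rightarrow> nat \<Rightarrow> bool" where
  "admissible x W \<longleftrightarrow> (\<exists>n. \<exists>a\<in>A. \<exists>c\<ge>W. c + W < p ^ n \<and>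
      (\<forall>j. \<bar>j\<bar> \<le> int W \<longrightarrow> x j = D n a (nat (int c + j))))"

lemma admissibleI:
  assumes "a \<in> A" "W \<le> c" "c + W < p ^ n"
    and "\<And>j. \<bar>j\<bar> \<le> int W \<Longrightarrow> x j = D n a (nat (int c + j))"
  shows "admissible x W"
  unfolding admissible_def using assms by blast

text \<open>Arbitrary intervals are replaced by windows [-W, W], whose only parameter is the radius;
  \<open>c\<close> is the place of position 0 inside \<theta>^n(a). An occurrence of the window
  after a prefix \<open>ps\<close> has its centre at length ps + W, and conversely every interval
  lies in a window.\<close>

lemma X_iff: "x \<in> X \<longleftrightarrow> (\<forall>W. admissible x W)" (is "_ \<longleftrightarrow> ?R")
proof
  assume x: "x \<in> X"
  show ?R
  proof
    fix W :: nat
    obtain n a where na: "a \<in> A" "sublist (map x [- int W..int W]) ((apply_word \<theta> ^^ n) [a])"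
      using x unfolding two_sided_shift_def by blast
    then obtain ps ss where ps: "(apply_word \<theta> ^^ n) [a] = ps @ map x [- int W..int W] @ ss"
      by (auto simp: sublist_def)
    from arg_cong[OF this, of length] have l: "p ^ n = length ps + (2 * W + 1) + length ss"
      using na word_power_singleton by simp
    have "x j = D n a (nat (int (length ps + W) + j))" if "\<bar>j\<bar> \<le> int W" for j
    proof -
      define k where "k = nat (j + int W)"
      have k: "k < 2 * W + 1" "nat (int (length ps + W) + j) = length ps + k" "- int W + int k = j"
        using that by (auto simp: k_def)
      have "D n a (length ps + k) = map x [- int W..int W] ! k"
        unfolding power_letter_def ps using k(1) by (auto simp: nth_append nat_less_iff zless_nat_eq_int_zless)
      also have "\<dots> = x j"
        using k by (simp add: nth_upto)
      finally show ?thesis using k by simp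
    qed
    then show "admissible x W"
      using na l by (intro admissibleI[of a W "length ps + W" n]) auto
  qed
next
  assume R: ?R
  show "x \<in> X"
    unfolding two_sided_shift_def
  proof (clarify)
    fix i j :: int
    \<comment> \<open>The additional 1 makes W positive, so that \<open>c + W < p ^ n\<close> forces
      n \<ge> 1, as the definition of the shift demands.\<close>
    define W where "W = nat (max \<bar>i\<bar> \<bar>j\<bar>) + 1"
    obtain n a c where n: "a \<in> A" "c \<ge> W" "c + W < p ^ n"
      and x: "\<And>j. \<bar>j\<bar> \<le> int W \<Longrightarrow> x j = D n a (nat (int c + j))"
      using R unfolding admissible_def by metis
    let ?w = "(apply_word \<theta> ^^ n) [a]"
    have "n \<ge> 1" using n by (cases n) (auto simp: W_def)
    have "map x [i..j] = take (nat (j - i + 1)) (drop (nat (int c + i)) ?w)"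
    proof (rule nth_equalityI)
      have lw: "length ?w = p ^ n" using n word_power_singleton by auto
      have "nat (j - i + 1) \<le> p ^ n - nat (int c + i)"
        using n unfolding W_def by linarith
      then show l: "length (map x [i..j]) = length (take (nat (j - i + 1)) (drop (nat (int c + i)) ?w))"
        unfolding length_take length_drop lw by simp
      fix k assume k: "k < length (map x [i..j])"
      then have kj: "i + int k \<le> j" by simp
      have "int (nat (max \<bar>i\<bar> \<bar>j\<bar>)) = max \<bar>i\<bar> \<bar>j\<bar>" by simp
      with kj have "\<bar>i + int k\<bar> \<le> int W" unfolding W_def by linarith
      moreover have "nat (int c + i) + k = nat (int c + (i + int k))"
        using n unfolding W_def by linarith
      moreover have "nat (int c + i) \<le> p ^ n"
        using n unfolding W_def by linarith
      ultimately show "map x [i..j] ! k = take (nat (j - i + 1)) (drop (nat (int c + i)) ?w) ! k"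
        using k kj n lw x[of "i + int k"] by (simp add: nth_upto power_letter_def)
    qed
    then have "sublist (map x [i..j]) ?w"
      by (metis sublist_take sublist_drop sublist_order.order.trans)
    then show "\<exists>n\<ge>1. \<exists>a\<in>A. sublist (map x [i..j]) ((apply_word \<theta> ^^ n) [a])"
      using n \<open>n \<ge> 1\<close> by blast
  qed
qed

text \<open>A window of the larger radius W + p^N fits only into a word longer than p^N, so the
  exponent can be taken at least N.\<close>

lemma X_window:
  assumes "x \<in> X"
  obtains n a c where "a \<in> A" "N \<le> n" "W \<le> c" "c + W < p ^ n"
    "\<And>j. \<bar>j\<bar> \<le> int W \<Longrightarrow> x j = D n a (nat (int c + j))"
proof -
  define V where "V = W + p ^ N"
  obtain n a c where n: "a \<in> A" "V \<le> c" "c + V < p ^ n"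
    and x: "\<And>j. \<bar>j\<bar> \<le> int V \<Longrightarrow> x j = D n a (nat (int c + j))"
    using assms unfolding X_iff admissible_def by metis
  have "p ^ N < p ^ n" using n by (auto simp: V_def)
  then have "N \<le> n" using p_gt_1 by (simp add: power_strict_increasing_iff)
  moreover have "x j = D n a (nat (int c + j))" if "\<bar>j\<bar> \<le> int W" for j
    using that by (intro x) (auto simp: V_def intro: order_trans)
  ultimately show ?thesis using n by (intro that[of a n c]) (auto simp: V_def)
qed

lemma X_in: "x \<in> X \<Longrightarrow> x i \<in> A"
proof -
  assume "x \<in> X"
  then obtain n a c where n: "a \<in> A" "nat \<bar>i\<bar> \<le> c" "c + nat \<bar>i\<bar> < p ^ n"
    and x: "\<And>j. \<bar>j\<bar> \<le> int (nat \<bar>i\<bar>) \<Longrightarrow> x j = D n a (nat (int c + j))"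
    using X_window[of x "nat \<bar>i\<bar>"] by metis
  have "x i = D n a (nat (int c + i))" by (rule x) auto
  moreover have "nat (int c + i) < p ^ n" using n by auto
  ultimately show ?thesis using n D_in by simp
qed

lemma X_closed:
  assumes "\<And>W::nat. \<exists>z\<in>X. \<forall>j. \<bar>j\<bar> \<le> int W \<longrightarrow> z j = g j"
  shows "g \<in> X"
  unfolding X_iff
proof
  fix W :: nat
  obtain z where z: "z \<in> X" "\<And>j. \<bar>j\<bar> \<le> int W \<Longrightarrow> z j = g j" using assms by blast
  from z(1) show "admissible g W"
    unfolding X_iff admissible_def using z(2) by metis
qed

lemma shift_by_in_X:
  assumes "x \<in> X" shows "shift_by r x \<in> X"
  unfolding X_iff
proof
  fix W :: nat
  obtain n a c where n: "a \<in> A" "W + nat \<bar>r\<bar> \<le> c" "c + (W + nat \<bar>r\<bar>) < p ^ n"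
    and x: "\<And>j. \<bar>j\<bar> \<le> int (W + nat \<bar>r\<bar>) \<Longrightarrow> x j = D n a (nat (int c + j))"
    using X_window[OF assms] by metis
  show "admissible (shift_by r x) W"
  proof (rule admissibleI[OF n(1)])
    show "W \<le> nat (int c + r)" "nat (int c + r) + W < p ^ n"
      using n by linarith+
    fix j assume "\<bar>j\<bar> \<le> int W"
    then have "x (j + r) = D n a (nat (int c + (j + r)))" by (intro x) auto
    then show "shift_by r x j = D n a (nat (int (nat (int c + r)) + j))"
      using n by (simp add: shift_by_def ac_simps)
  qed
qed

text \<open>A window centred at c in \<theta>^n(a) is sent to one centred at c * p^m in
  \<theta>^(m+n)(a).\<close>

lemma T_in_X:
  assumes "x \<in> X" shows "T m x \<in> X"
  unfolding X_iff
proof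
  fix W :: nat
  let ?P = "p ^ m"
  obtain n a c where n: "a \<in> A" "W \<le> c" "c + W < p ^ n"
    and x: "\<And>j. \<bar>j\<bar> \<le> int W \<Longrightarrow> x j = D n a (nat (int c + j))"
    using X_window[OF assms] by metis
  have P: "?P > 0" by simp
  have "W * 1 \<le> W * ?P" using P by (intro mult_left_mono) (auto simp: Suc_le_eq)
  then have "W \<le> W * ?P" by simp
  have "(c + W + 1) * ?P \<le> p ^ n * ?P" using n by (intro mult_right_mono) auto
  then have bound: "c * ?P + W * ?P + ?P \<le> p ^ (m + n)"
    by (simp add: algebra_simps power_add)
  show "admissible (T m x) W"
  proof (rule admissibleI[OF n(1)])
    show "W \<le> c * ?P" using n \<open>W \<le> W * ?P\<close> mult_right_mono[of W c ?P] by linarith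
    show "c * ?P + W < p ^ (m + n)" using bound P \<open>W \<le> W * ?P\<close> by linarith
    fix j assume j: "\<bar>j\<bar> \<le> int W"
    have "T m x j = D m (D n a (nat (int c + j div int ?P))) (nat (j mod int ?P))"
      unfolding power_biinf_def using x[of "j div int ?P"] abs_div_le[OF j P] by simp
    also have "int c + j div int ?P = (int (c * ?P) + j) div int ?P"
      using P by simp
    also have "j mod int ?P = (int (c * ?P) + j) mod int ?P"
      using P by simp
    also have "D m (D n a (nat ((int (c * ?P) + j) div int ?P))) (nat ((int (c * ?P) + j) mod int ?P))
        = D (m + n) a (nat (int (c * ?P) + j))"
    proof (rule D_add_int[symmetric, OF n(1)])
      show "0 \<le> int (c * ?P) + j" using \<open>W \<le> c * ?P\<close> j by linarith
      show "int (c * ?P) + j < int (p ^ (m + n))"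
        using \<open>c * ?P + W < p ^ (m + n)\<close> j by linarith
    qed
    finally show "T m x j = D (m + n) a (nat (int (c * ?P) + j))" .
  qed
qed

lemma T_add:
  assumes "x \<in> X" shows "T (m + n) x = T m (T n x)"
proof
  fix j
  let ?P = "int (p ^ m)" and ?Q = "int (p ^ n)"
  define r where "r = j mod int (p ^ (m + n))"
  have pos: "?P > 0" "?Q > 0" "int (p ^ (m + n)) > 0" by simp_all
  have eq: "int (p ^ (m + n)) = ?P * ?Q" by (simp add: power_add)
  have r: "0 \<le> r" "r < int (p ^ (m + n))"
    using pos by (simp_all add: r_def)
  have "T (m + n) x j = D (m + n) (x (j div int (p ^ (m + n)))) (nat r)"
    by (simp add: power_biinf_def r_def)
  also have "\<dots> = D m (D n (x (j div int (p ^ (m + n)))) (nat (r div ?P))) (nat (r mod ?P))"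
    using r X_in[OF assms] by (intro D_add_int)
  also have "j div int (p ^ (m + n)) = (j div ?P) div ?Q"
    unfolding eq using pos by (simp add: zdiv_zmult2_eq)
  also have "r div ?P = (j div ?P) mod ?Q"
    unfolding r_def eq using pos by (subst zmod_zmult2_eq) auto
  also have "r mod ?P = j mod ?P"
    unfolding r_def eq by (simp add: mod_mult_self2 mod_mod_cancel)
  finally show "T (m + n) x j = T m (T n x) j"
    by (simp add: power_biinf_def)
qed

lemma T_shift_by: "T n (shift_by r x) = shift_by (r * int (p ^ n)) (T n x)"
  by (auto simp: fun_eq_iff power_biinf_def shift_by_def add.commute)

section \<open>Minimality and compactness\<close>

lemma occurs:
  assumes x: "x \<in> X" and a: "a \<in> A"
  obtains i where "\<And>j. j < p ^ N \<Longrightarrow> x (i + int j) = D N a j"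
proof -
  obtain k where k: "\<And>b. b \<in> A \<Longrightarrow> a \<in> set ((apply_word \<theta> ^^ k) [b])"
    using prim a by (auto simp: primitive_def)
  \<comment> \<open>A window of radius P contains the whole aligned block \<theta>^(N+k)(b') in
    which its centre lies. By the choice of k the word \<theta>^k(b') contains a, so the block
    contains \<theta>^N(a).\<close>
  define P where "P = p ^ (N + k)"
  obtain n b c where n: "b \<in> A" "N + k \<le> n" "P \<le> c" "c + P < p ^ n"
    and xc: "\<And>j. \<bar>j\<bar> \<le> int P \<Longrightarrow> x j = D n b (nat (int c + j))"
    using X_window[OF x] by metis
  have P: "P > 0" by (simp add: P_def)
  define q where "q = c div P"
  have q: "q * P \<le> c" "c < q * P + P"
    using P div_mult_mod_eq[of c P] mod_less_divisor[OF P, of c] unfolding q_def by linarith+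
  obtain m where m: "n = (N + k) + m" using n le_Suc_ex by blast
  have qm: "q < p ^ m"
  proof -
    have "q * P < p ^ n" using q n by linarith
    also have "p ^ n = p ^ m * P" by (simp add: m P_def power_add)
    finally show ?thesis by simp
  qed
  define b' where "b' = D m b q"
  have b': "b' \<in> A" using D_in n qm by (auto simp: b'_def)
  obtain t where t: "t < p ^ k" "D k b' t = a"
    using k[OF b'] word_power_singleton[OF b'] by (auto simp: in_set_conv_nth power_letter_def)
  show ?thesis
  proof (rule that[of "int (q * P + t * p ^ N) - int c"])
    fix j assume j: "j < p ^ N"
    have "t * p ^ N + j < (t + 1) * p ^ N" using j by simp
    also have "\<dots> \<le> p ^ k * p ^ N" using t by (intro mult_right_mono) auto
    finally have tj: "t * p ^ N + j < P" by (simp add: P_def power_add mult.commute)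
    have "x (int (q * P + t * p ^ N) - int c + int j)
        = D n b (nat (int c + (int (q * P + t * p ^ N) - int c + int j)))"
      by (rule xc) (use q tj in \<open>simp only: abs_le_iff; linarith\<close>)
    also have "nat (int c + (int (q * P + t * p ^ N) - int c + int j)) = q * P + (t * p ^ N + j)"
      by linarith
    also have "D n b \<dots> = D (N + k) b' (t * p ^ N + j)"
      unfolding m b'_def P_def using n tj qm by (intro D_add_split) (auto simp: P_def)
    also have "\<dots> = D N a j"
      using D_add_split[OF b' j t(1)] t by simp
    finally show "x (int (q * P + t * p ^ N) - int c + int j) = D N a j" .
  qed
qed

text \<open>A window of y lies in some \<theta>^n(a), and by \<open>occurs\<close> that whole word
  appears in x.\<close>

lemma minimal:
  assumes "x \<in> X" "y \<in> X"
  obtains i where "\<And>j. \<bar>j\<bar> \<le> int W \<Longrightarrow> y j = x (i + j)"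
proof -
  obtain n a c where n: "a \<in> A" "W \<le> c" "c + W < p ^ n"
    and y: "\<And>j. \<bar>j\<bar> \<le> int W \<Longrightarrow> y j = D n a (nat (int c + j))"
    using X_window[OF assms(2)] by metis
  obtain i where i: "\<And>j. j < p ^ n \<Longrightarrow> x (i + int j) = D n a j"
    using occurs[OF assms(1) n(1)] by metis
  have "y j = x (i + int c + j)" if "\<bar>j\<bar> \<le> int W" for j
  proof -
    have "nat (int c + j) < p ^ n" using that n by linarith
    from i[OF this] y[OF that] have "y j = x (i + int (nat (int c + j)))" by simp
    also have "i + int (nat (int c + j)) = i + int c + j" using that n by linarith
    finally show ?thesis .
  qed
  then show ?thesis by (rule that)
qed

lemma compact:
  assumes f: "\<And>N::nat. f N \<in> X"
  obtains g where "g \<in> X" "\<And>W. \<exists>N\<ge>W. \<forall>j. \<bar>j\<bar> \<le> int W \<longrightarrow> f N j = g j"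
proof -
  \<comment> \<open>Infinitely many indices survive at every radius: this permits the next
    pigeonhole choice and finally yields indices N \<ge> W.\<close>
  define good where
    "good W h \<longleftrightarrow> infinite {N. \<forall>j. \<bar>j\<bar> \<le> int W \<longrightarrow> f N j = h j}" for W h
  have extend: "\<exists>N\<in>I. good W' (f N)" if I: "infinite I" for I W'
  proof -
    let ?r = "\<lambda>N. restrict (f N) {- int W'..int W'}"
    have "?r ` I \<subseteq> PiE {- int W'..int W'} (\<lambda>_. A)"
      using X_in[OF f] by (auto simp: PiE_def extensional_def)
    moreover have "finite (PiE {- int W'..int W'} (\<lambda>_. A))"
      using finA by (intro finite_PiE) auto
    ultimately obtain N where N: "N \<in> I" "infinite {N' \<in> I. ?r N' = ?r N}"
      using pigeonhole_infinite[OF I, of ?r] finite_subset by blast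
    have eq: "f N' j = f N j" if "?r N' = ?r N" "\<bar>j\<bar> \<le> int W'" for N' j
      using fun_cong[OF that(1), of j] that(2) by (simp add: restrict_def abs_le_iff split: if_splits)
    have "infinite {N'. \<forall>j. \<bar>j\<bar> \<le> int W' \<longrightarrow> f N' j = f N j}"
      by (rule infinite_super[OF _ N(2)]) (use eq in blast)
    then have "good W' (f N)" by (simp add: good_def)
    then show ?thesis using N(1) by blast
  qed
  have "\<exists>h. \<forall>W. good W (h W) \<and> (\<forall>j. \<bar>j\<bar> \<le> int W \<longrightarrow> h (Suc W) j = h W j)"
  proof (rule dependent_nat_choice)
    show "\<exists>h. good 0 h" using extend[of UNIV 0] by auto
  next
    fix h W assume h: "good W h"
    define I where "I = {N. \<forall>j. \<bar>j\<bar> \<le> int W \<longrightarrow> f N j = h j}"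
    have "\<exists>N\<in>I. good (Suc W) (f N)"
      by (rule extend) (use h in \<open>simp add: good_def I_def\<close>)
    then show "\<exists>h'. good (Suc W) h' \<and> (\<forall>j. \<bar>j\<bar> \<le> int W \<longrightarrow> h' j = h j)"
      unfolding I_def by blast
  qed
  then obtain h where h: "\<And>W. good W (h W)"
    and hs: "\<And>W j. \<bar>j\<bar> \<le> int W \<Longrightarrow> h (Suc W) j = h W j" by blast
  have h_mono: "h V j = h W j" if "W \<le> V" "\<bar>j\<bar> \<le> int W" for V W j
    using that by (induction V rule: dec_induct) (auto simp: hs)
  \<comment> \<open>The limit reads position j at the first stage whose window contains it; by
    \<open>h_mono\<close> later stages do not change that letter.\<close>
  define g where "g j = h (nat \<bar>j\<bar>) j" for j
  have g: "\<exists>N\<ge>W. \<forall>j. \<bar>j\<bar> \<le> int W \<longrightarrow> f N j = g j" for W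
  proof -
    obtain N where N: "N \<ge> W" "\<forall>j. \<bar>j\<bar> \<le> int W \<longrightarrow> f N j = h W j"
      using h[of W] unfolding good_def infinite_nat_iff_unbounded_le by blast
    moreover have "h W j = g j" if "\<bar>j\<bar> \<le> int W" for j
      unfolding g_def using that by (intro h_mono) auto
    ultimately show ?thesis by auto
  qed
  have "g \<in> X"
    by (rule X_closed) (use g f in blast)
  then show ?thesis using g that by blast
qed

section \<open>Closed images and existence of desubstitutions\<close>

lemma T_image_closed:
  assumes "\<And>W::nat. \<exists>z\<in>X. \<forall>j. \<bar>j\<bar> \<le> int W \<longrightarrow> y j = T n z (j + k)"
  shows "\<exists>z\<in>X. y = shift_by k (T n z)"
proof -
  obtain f where f: "\<And>W::nat. f W \<in> X"
    "\<And>W j. \<bar>j\<bar> \<le> int W \<Longrightarrow> y j = T n (f W) (j + k)"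
    using assms by metis
  obtain g where g: "g \<in> X" "\<And>W. \<exists>N\<ge>W. \<forall>j. \<bar>j\<bar> \<le> int W \<longrightarrow> f N j = g j"
    using compact[of f] f by metis
  have "y j = T n g (j + k)" for j
  proof -
    \<comment> \<open>The letter at j + k depends on the single letter i of the preimage, so
      agreement of some \<open>f N\<close> with the limit at i suffices.\<close>
    define i where "i = (j + k) div int (p ^ n)"
    obtain N where N: "N \<ge> nat \<bar>j\<bar> + nat \<bar>i\<bar>" "f N i = g i"
      using g(2)[of "nat \<bar>j\<bar> + nat \<bar>i\<bar>"] by auto
    then have "y j = T n (f N) (j + k)" by (intro f(2)) auto
    also have "\<dots> = T n g (j + k)" using N(2) by (simp add: power_biinf_def i_def)
    finally show ?thesis .
  qed
  then show ?thesis using g(1) by (auto simp: shift_by_def fun_eq_iff)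
qed

text \<open>A window of y inside \<theta>^m(a), m = n + m', is cut into blocks of length p^n indexed
  by the letters of \<theta>^m'(a). That word occurs in y itself, so a translate of y is a preimage
  on this window. Only p^n phases are possible, so one serves all windows, and compactness gives a
  common z.\<close>

lemma desubstitute:
  assumes y: "y \<in> X"
  shows "\<exists>k<p ^ n. \<exists>z\<in>X. y = shift_by (int k) (T n z)"
proof -
  let ?P = "p ^ n"
  define Q where
    "Q k W \<longleftrightarrow> (\<exists>z\<in>X. \<forall>j. \<bar>j\<bar> \<le> int W \<longrightarrow> y j = T n z (j + int k))" for k W
  have "\<exists>k\<in>{..<?P}. \<forall>W. Q k W"
  proof (rule finite_antimono_choice)
    fix W
    obtain m a c where m: "a \<in> A" "n \<le> m" "W \<le> c" "c + W < p ^ m"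
      and yc: "\<And>j. \<bar>j\<bar> \<le> int W \<Longrightarrow> y j = D m a (nat (int c + j))"
      using X_window[OF y] by metis
    define m' where "m' = m - n"
    have m': "m = n + m'" using m by (simp add: m'_def)
    obtain i where i: "\<And>j. j < p ^ m' \<Longrightarrow> y (i + int j) = D m' a j"
      using occurs[OF y m(1)] by metis
    \<comment> \<open>The word \<theta>^m'(a) starts at i in y. This translate puts at position 0
      its letter number c div p^n, whose block contains the centre c; the rest of c is the phase c
      mod p^n.\<close>
    define z where "z = shift_by (i + int (c div ?P)) y"
    have "y j = T n z (j + int (c mod ?P))" if j: "\<bar>j\<bar> \<le> int W" for j
    proof -
      let ?t = "(int c + j) div int ?P"
      have "int ?P > 0" by simp
      then have pos: "int ?P \<noteq> 0" by linarith
      have "c = c mod ?P + (c div ?P) * ?P" by (rule mod_div_mult_eq[symmetric])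
      then have "int c = int (c mod ?P) + int (c div ?P) * int ?P"
        by (metis of_nat_add of_nat_mult)
      then have split: "int c + j = (j + int (c mod ?P)) + int (c div ?P) * int ?P" by linarith
      have shift_div: "?t = int (c div ?P) + (j + int (c mod ?P)) div int ?P"
        unfolding split by (rule div_mult_self1[OF pos])
      have shift_mod: "(int c + j) mod int ?P = (j + int (c mod ?P)) mod int ?P"
        unfolding split by (rule mod_mult_self1)
      have pos: "0 \<le> int c + j" "int c + j < int (p ^ (n + m'))"
        using j m unfolding m'[symmetric] by linarith+
      have "?t < int (p ^ m')"
      proof -
        have v: "int c + j = int (nat (int c + j))" using pos(1) by simp
        have "nat (int c + j) < p ^ m' * p ^ n"
          using pos by (simp add: nat_less_iff power_add mult.commute)
        then have "nat (int c + j) div p ^ n < p ^ m'" by (rule less_mult_imp_div_less)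
        then show ?thesis by (subst v) (simp only: zdiv_int[symmetric] of_nat_less_iff)
      qed
      moreover have "?t \<ge> 0" using pos(1) by (simp add: pos_imp_zdiv_nonneg_iff)
      ultimately have t: "y (i + ?t) = D m' a (nat ?t)"
        using i[of "nat ?t"] by (simp add: nat_less_iff del: of_nat_power)
      have "y j = D n (D m' a (nat ?t)) (nat ((int c + j) mod int ?P))"
        using yc[OF j] D_add_int[OF m(1) pos] m' by simp
      also have "\<dots> = D n (y (i + ?t)) (nat ((int c + j) mod int ?P))"
        by (simp only: t)
      also have "\<dots> = T n z (j + int (c mod ?P))"
        unfolding power_biinf_def z_def shift_by_def shift_div shift_mod
        by (simp add: ac_simps)
      finally show ?thesis .
    qed
    moreover have "z \<in> X" unfolding z_def by (rule shift_by_in_X[OF y])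
    ultimately show "\<exists>k\<in>{..<?P}. Q k W"
      unfolding Q_def by (intro bexI[of _ "c mod ?P"]) auto
  next
    fix k W W' assume "W \<le> W'" "Q k W'"
    then show "Q k W" unfolding Q_def by (meson of_nat_mono order_trans)
  qed simp
  then show ?thesis unfolding Q_def using T_image_closed[of y n] by blast
qed

section \<open>Uniqueness of the cutting points\<close>

text \<open>A relation between two images spreads from one point to the whole shift: each window of
  z is a window of z0 around some i, and the given equation can be translated by i blocks.\<close>

lemma T_image_translate:
  assumes z0: "z0 \<in> X" and z0': "z0' \<in> X" and eq: "T n z0 = shift_by k (T n z0')"
    and z: "z \<in> X"
  shows "\<exists>z'\<in>X. T n z = shift_by k (T n z')"
proof (rule T_image_closed)
  fix W :: nat
  obtain i where i: "\<And>j. \<bar>j\<bar> \<le> int W \<Longrightarrow> z j = z0 (i + j)"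
    using minimal[OF z0 z] by metis
  have "T n z j = T n (shift_by i z0') (j + k)" if j: "\<bar>j\<bar> \<le> int W" for j
  proof -
    have "T n z j = T n (shift_by i z0) j"
      using i[of "j div int (p ^ n)"] abs_div_le[OF j, of "p ^ n"]
      by (simp add: power_biinf_def shift_by_def add.commute)
    also have "T n (shift_by i z0) = shift_by k (T n (shift_by i z0'))"
      by (simp add: T_shift_by eq add.commute)
    finally show ?thesis by (simp add: shift_by_def)
  qed
  then show "\<exists>z'\<in>X. \<forall>j. \<bar>j\<bar> \<le> int W \<longrightarrow> T n z j = T n z' (j + k)"
    using shift_by_in_X[OF z0'] by blast
qed

lemma period_transfer:
  assumes "x \<in> X" "y \<in> X" "shift_by (int q) x = x"
  shows "shift_by (int q) y = y"
proof
  fix j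
  obtain i where i: "\<And>l. \<bar>l\<bar> \<le> int (nat \<bar>j\<bar> + q) \<Longrightarrow> y l = x (i + l)"
    using minimal[OF assms(1,2)] by metis
  have "y (j + int q) = x (i + j + int q)" using i[of "j + int q"] by (simp add: add.assoc)
  also have "\<dots> = x (i + j)" using fun_cong[OF assms(3), of "i + j"] by (simp add: shift_by_def)
  also have "\<dots> = y j" using i[of j] by simp
  finally show "shift_by (int q) y j = y j" by (simp add: shift_by_def)
qed

lemma fixed_point_eq: "n < p ^ N \<Longrightarrow> fixed_point \<theta> a0 n = D N a0 n"
proof -
  assume "n < p ^ N"
  moreover have "n < p ^ n" by (rule less_p_power)
  moreover have "fixed_point \<theta> a0 n = D n a0 n" by (simp add: fixed_point_def power_letter_def)
  ultimately show ?thesis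
    using D_a0[of n n "N - n"] D_a0[of n N "n - N"] by (cases "n \<le> N") auto
qed

text \<open>Every initial segment of the fixed point occurs in x, so the period of x is visible on
  it.\<close>

lemma period_fixed_point:
  assumes "x \<in> X" "q > 0" "shift_by (int q) x = x"
  shows "is_period (fixed_point \<theta> a0) q"
  unfolding is_period_def
proof (intro conjI allI)
  fix n
  have N: "n + q < p ^ (n + q)" by (rule less_p_power)
  obtain i where i: "\<And>j. j < p ^ (n + q) \<Longrightarrow> x (i + int j) = D (n + q) a0 j"
    using occurs[OF assms(1) a0] by metis
  have "fixed_point \<theta> a0 (n + q) = x (i + int (n + q))"
    using i[OF N] fixed_point_eq[OF N] by simp
  also have "\<dots> = x (i + int n)"
    using fun_cong[OF assms(3), of "i + int n"] by (simp add: shift_by_def add.assoc)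
  also have "\<dots> = fixed_point \<theta> a0 n"
    using i[of n] fixed_point_eq[of n "n + q"] N by simp
  finally show "fixed_point \<theta> a0 (n + q) = fixed_point \<theta> a0 n" .
qed (use assms in simp)

text \<open>The words of length \<open>p\<^sup>m\<close> at the positions divisible by \<open>p\<^sup>r\<close> in \<open>\<theta>\<^sup>r(x)\<close> are among the
  words \<open>\<theta>\<^sup>m(a)\<close>, so there are boundedly many of them as \<open>m\<close> grows.\<close>

lemma periodic_if_absorbed:
  assumes absorbed: "\<And>m x. x \<in> X \<Longrightarrow> \<exists>z\<in>X. T r x = T (r + m) z" and x: "x \<in> X"
  obtains y q where "y \<in> X" "q > 0" "shift_by (int q) y = y"
proof -
  let ?R = "int (p ^ r)"
  define y where "y i = T r (shift_by (int i) x)" for i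
  \<comment> \<open>The card A + 1 starting points 0, ..., card A lead to at most card A letters, so
    two of them collide. I is the finite set of possible collisions, from which one valid for all
    radii is chosen.\<close>
  define I where "I = {(i, j). i < j \<and> j \<le> card A}"
  have "\<exists>ij\<in>I. \<forall>W. \<forall>l. \<bar>l\<bar> \<le> int W \<longrightarrow> y (fst ij) l = y (snd ij) l"
  proof (rule finite_antimono_choice)
    have "I \<subseteq> {..card A} \<times> {..card A}" by (auto simp: I_def)
    then show "finite I" by (rule finite_subset) simp
  next
    fix W :: nat
    \<comment> \<open>Then p^m \<ge> 2 W + 1, so the block of length p^(r+m) at position 0 covers
      the window of radius W around W p^r. Starting the preimage at i - W puts the central window of
      \<open>y i\<close> there.\<close>
    define m where "m = 2 * W"
    have "\<exists>z\<in>X. T r (shift_by (int i - int W) x) = T (r + m) z" for i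
      by (intro absorbed shift_by_in_X x)
    then obtain z where z: "\<And>i. z i \<in> X" "\<And>i. T r (shift_by (int i - int W) x) = T (r + m) (z i)"
      by metis
    have "\<not> inj_on (\<lambda>i. z i 0) {..card A}"
    proof
      assume "inj_on (\<lambda>i. z i 0) {..card A}"
      then have "card {..card A} \<le> card A"
        by (rule card_inj_on_le) (use finA X_in z in auto)
      then show False by simp
    qed
    then obtain i j where ij: "i < j" "j \<le> card A" "z i 0 = z j 0"
      unfolding inj_on_def by (metis atMost_iff linorder_neqE_nat)
    have shifted: "y i l = T (r + m) (z i) (l + int W * ?R)" for i l
    proof -
      have "y i = T r (shift_by (int W) (shift_by (int i - int W) x))"
        by (simp add: y_def)
      also have "\<dots> = shift_by (int W * ?R) (T r (shift_by (int i - int W) x))"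
        by (rule T_shift_by)
      also note z(2)
      finally show ?thesis by (simp add: shift_by_def)
    qed
    have "y i l = y j l" if l: "\<bar>l\<bar> \<le> int W" for l
    proof -
      have "int W * 1 \<le> int W * ?R" by (intro mult_left_mono) (auto simp: Suc_le_eq)
      then have W: "int W \<le> int W * ?R" by simp
      have "2 * W + 1 \<le> p ^ m" using less_p_power[of m] by (simp add: m_def)
      then have "int (2 * W + 1) * ?R \<le> int (p ^ m) * ?R"
        by (intro mult_right_mono) (simp_all only: of_nat_le_iff of_nat_0_le_iff)
      also have "\<dots> = int (p ^ (r + m))" by (simp add: power_add)
      finally have "int W * ?R + int W * ?R + ?R \<le> int (p ^ (r + m))"
        by (simp add: algebra_simps)
      then have "0 \<le> l + int W * ?R" "l + int W * ?R < int (p ^ (r + m))"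
        using W l by (auto simp: abs_le_iff) (smt (verit) zero_less_power of_nat_0_less_iff p_pos)+
      then have "(l + int W * ?R) div int (p ^ (r + m)) = 0" by (rule div_pos_pos_trivial)
      then show ?thesis unfolding shifted power_biinf_def using ij by simp
    qed
    then show "\<exists>ij\<in>I. \<forall>l. \<bar>l\<bar> \<le> int W \<longrightarrow> y (fst ij) l = y (snd ij) l"
      using ij by (intro bexI[of _ "(i, j)"]) (auto simp: I_def)
  qed (meson of_nat_mono order_trans)
  then obtain i j where ij: "i < j" and eq: "\<And>W l. \<bar>l\<bar> \<le> int W \<Longrightarrow> y i l = y j l"
    by (auto simp: I_def)
  have yij: "y i = y j"
  proof
    fix l show "y i l = y j l" using eq[of l "nat \<bar>l\<bar>"] by simp
  qed
  have "y j = T r (shift_by (int (j - i)) (shift_by (int i) x))"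
    using ij by (simp add: y_def of_nat_diff)
  also have "\<dots> = shift_by (int ((j - i) * p ^ r)) (y i)"
    unfolding T_shift_by y_def by simp
  finally have "shift_by (int ((j - i) * p ^ r)) (y i) = y i" using yij by simp
  moreover have "y i \<in> X" unfolding y_def by (intro T_in_X shift_by_in_X x)
  ultimately show ?thesis using ij by (intro that[of "y i" "(j - i) * p ^ r"]) auto
qed

text \<open>By contradiction: an offset not divisible by p^n gives the set of images so many
  translations that all points are periodic. Then z' is a translate of z, and k corrected by a
  multiple of p^n is a period to which \<open>periods\<close> applies.\<close>

lemma cutting_points_unique:
  assumes periods: "\<And>q. is_period (fixed_point \<theta> a0) q \<Longrightarrow> p ^ n dvd q"
    and z: "z \<in> X" and z': "z' \<in> X" and eq: "T n z = shift_by k (T n z')"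
  shows "int (p ^ n) dvd k"
proof (rule ccontr)
  assume ndvd: "\<not> int (p ^ n) dvd k"
  \<comment> \<open>These are the r for which the set of images lies in its own translate by r. They
    include k and all multiples of p^n and are closed under addition; the aim is to reach
    p^(n-1).\<close>
  define stable where "stable r \<longleftrightarrow> (\<forall>z\<in>X. \<exists>z'\<in>X. T n z = shift_by r (T n z'))" for r
  have stable_k: "stable k"
    unfolding stable_def using T_image_translate[OF z z' eq] by blast
  have stable_add: "stable (r + s)" if "stable r" "stable s" for r s
    using that unfolding stable_def by (metis shift_by_shift_by)
  have stable_multiple: "stable (i * int (p ^ n))" for i
    unfolding stable_def
  proof
    fix x assume "x \<in> X"
    moreover have "T n x = shift_by (i * int (p ^ n)) (T n (shift_by (- i) x))"
      by (simp add: T_shift_by)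
    ultimately show "\<exists>z'\<in>X. T n x = shift_by (i * int (p ^ n)) (T n z')"
      using shift_by_in_X by blast
  qed
  have stable_mult: "stable (int i * r)" if "stable r" for i r
  proof (induction i)
    case 0
    then show ?case using stable_multiple[of 0] by simp
  next
    case (Suc i)
    from stable_add[OF that this] show ?case by (simp add: algebra_simps)
  qed
  \<comment> \<open>The gcd divides p^n, so it is some p^m, and m = n would make p^n divide k.
    Reducing k first makes it nonnegative, so that the description of the divisors of a prime power
    in the natural numbers applies.\<close>
  have "\<exists>m<n. gcd (k mod int (p ^ n)) (int (p ^ n)) = int (p ^ m)"
  proof -
    have "gcd (nat (k mod int (p ^ n))) (p ^ n) dvd p ^ n" by simp
    then obtain m where m: "m \<le> n" "gcd (nat (k mod int (p ^ n))) (p ^ n) = p ^ m"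
      using divides_primepow_nat[OF p] by blast
    have g: "gcd (k mod int (p ^ n)) (int (p ^ n)) = int (p ^ m)"
    proof -
      have "int (nat (k mod int (p ^ n))) = k mod int (p ^ n)" by simp
      then show ?thesis using m(2) by (metis gcd_int_int_eq)
    qed
    have "m \<noteq> n"
    proof
      assume "m = n"
      then have "int (p ^ n) dvd k mod int (p ^ n)" using g by (metis gcd_dvd1)
      then show False using ndvd by (simp add: dvd_mod_iff del: of_nat_power)
    qed
    then show ?thesis using m g by (intro exI[of _ m]) auto
  qed
  then obtain m where m: "m < n" "gcd k (int (p ^ n)) = int (p ^ m)"
    by (auto simp: gcd_mod_left simp del: of_nat_power)
  obtain u v where uv: "u * k + v * int (p ^ n) = int (p ^ m)"
    using bezout_int[of k "int (p ^ n)"] m by auto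
  define r where "r = n - 1"
  have n: "n = r + 1" using m by (simp add: r_def)
  have stable_r: "stable (int (p ^ r))"
  proof -
    \<comment> \<open>The Bezout coefficient u may be negative, whereas \<open>stable_mult\<close>
      treats natural factors. Its residue w changes u * k only by a multiple of p^n, which is
      stable. The factor ?c raises p^m to p^(n-1).\<close>
    let ?c = "p ^ (r - m)"
    define w where "w = nat (u mod int (p ^ n))"
    have w: "u = int w + (u div int (p ^ n)) * int (p ^ n)"
      by (simp add: w_def del: of_nat_power)
    have "int (p ^ r) = int ?c * int (p ^ m)"
      using m by (simp add: n flip: power_add)
    also have "\<dots> = int (?c * w) * k + (int ?c * (v + (u div int (p ^ n)) * k)) * int (p ^ n)"
      unfolding uv[symmetric] by (subst w) (simp add: algebra_simps del: of_nat_power)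
    finally show ?thesis
      using stable_add[OF stable_mult[OF stable_k] stable_multiple] by metis
  qed
  have stable_all: "stable (i * int (p ^ r))" for i
  proof -
    have "i * int (p ^ r) = int (nat (i mod int p)) * int (p ^ r) + (i div int p) * int (p ^ n)"
    proof -
      have "i = int (nat (i mod int p)) + (i div int p) * int p" by simp
      then have "i * int (p ^ r) = (int (nat (i mod int p)) + (i div int p) * int p) * int (p ^ r)"
        by simp
      also have "\<dots> = int (nat (i mod int p)) * int (p ^ r) + (i div int p) * int (p ^ n)"
        unfolding n by (simp only: distrib_left distrib_right power_add power_one_right of_nat_mult mult_ac)
      finally show ?thesis .
    qed
    then show ?thesis using stable_add[OF stable_mult[OF stable_r] stable_multiple] by metis
  qed
  \<comment> \<open>Desubstituting x once leaves a shift by j, which T r turns into a shift by j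
    p^r; stability under -j p^r cancels it.\<close>
  have step: "\<exists>w\<in>X. T r x = T n w" if x: "x \<in> X" for x
  proof -
    obtain j w where w: "w \<in> X" "x = shift_by (int j) (T 1 w)"
      using desubstitute[OF x, of 1] by blast
    obtain w' where w': "w' \<in> X" "T n w = shift_by (- int j * int (p ^ r)) (T n w')"
      using stable_all[of "- int j"] w(1) unfolding stable_def by blast
    have "T r x = shift_by (int j * int (p ^ r)) (T r (T 1 w))"
      using w by (simp only: T_shift_by)
    also have "T r (T 1 w) = T n w" using T_add[OF w(1), of r 1] n by simp
    finally show ?thesis using w' by (intro bexI[of _ w']) simp_all
  qed
  have absorbed: "\<exists>w\<in>X. T r x = T (r + m) w" if "x \<in> X" for m x
    using that
  proof (induction m arbitrary: x)
    case (Suc m)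
    obtain w where w: "w \<in> X" "T r x = T n w" using step[OF Suc.prems] by blast
    obtain w' where w': "w' \<in> X" "T r w = T (r + m) w'" using Suc.IH[OF w(1)] by blast
    have "T n w = T 1 (T r w)" using T_add[OF w(1), of 1 r] n by simp
    also have "\<dots> = T (r + Suc m) w'" using T_add[OF w'(1), of 1 "r + m"] w'(2) by simp
    finally show ?case using w w' by auto
  qed auto
  obtain y q where y: "y \<in> X" "q > 0" "shift_by (int q) y = y"
    by (rule periodic_if_absorbed[of r z]) (use absorbed z in auto)
  obtain i where i: "\<And>j. \<bar>j\<bar> \<le> int q \<Longrightarrow> z' j = z (i + j)"
    using minimal[OF z z'] by metis
  \<comment> \<open>Minimality transfers the period q to both points. They agree up to translation
    on a window containing a full period, hence everywhere.\<close>
  have z'_eq: "z' = shift_by i z"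
  proof
    fix j
    have per: "x (j mod int q + l * int q) = x (j mod int q)" if "shift_by (int q) x = x" for x :: "int \<Rightarrow> 'a" and j l
      using fun_cong[OF shift_by_multiple[OF that, of l], of "j mod int q"] by (simp add: shift_by_def)
    have j: "j mod int q + (j div int q) * int q = j" by simp
    have "z' j = z' (j mod int q)"
      using per[OF period_transfer[OF y(1) z' y(3)], of j "j div int q"] by simp
    also have "\<dots> = shift_by i z (j mod int q)"
    proof -
      have "0 \<le> j mod int q" "j mod int q < int q" using y(2) by simp_all
      then have "\<bar>j mod int q\<bar> \<le> int q" by linarith
      then show ?thesis using i by (simp add: shift_by_def add.commute)
    qed
    also have "\<dots> = shift_by i z j"
      using per[OF period_transfer[OF y(1) shift_by_in_X[OF z] y(3)], of i j "j div int q"] by simp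
    finally show "z' j = shift_by i z j" .
  qed
  \<comment> \<open>Replacing z' by the translate of z turns the given equation into invariance of T
    n z under l. Since p^n does not divide k, l is nonzero.\<close>
  define l where "l = k + i * int (p ^ n)"
  have l: "T n z = shift_by l (T n z)"
  proof -
    have "T n z = shift_by k (T n (shift_by i z))" using eq z'_eq by simp
    then show ?thesis by (simp only: T_shift_by shift_by_shift_by l_def)
  qed
  have "l \<noteq> 0"
  proof
    assume "l = 0"
    then have "k = - i * int (p ^ n)" by (simp add: l_def)
    then show False using ndvd by simp
  qed
  moreover have "shift_by (int (nat \<bar>l\<bar>)) (T n z) = T n z"
    using l shift_by_eq_iff[of "T n z" l "T n z"] by (cases "l \<ge> 0") auto
  ultimately have "is_period (fixed_point \<theta> a0) (nat \<bar>l\<bar>)"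
    by (intro period_fixed_point[OF T_in_X[OF z]]) auto
  then have "p ^ n dvd nat \<bar>l\<bar>" by (rule periods)
  then have "int (p ^ n) dvd l" using int_dvd_int_iff[of "p ^ n" "nat \<bar>l\<bar>"] by (simp del: of_nat_power int_dvd_int_iff)
  then have "int (p ^ n) dvd k"
    unfolding l_def by (simp add: dvd_add_left_iff del: of_nat_power)
  then show False using ndvd by simp
qed

section \<open>Stabilization of the relation on letters given by equal images\<close>

lemma powers_eq_stable:
  obtains N where "\<And>a b. a \<in> A \<Longrightarrow> b \<in> A \<Longrightarrow> \<forall>i < p ^ Suc N. D (Suc N) a i = D (Suc N) b i \<Longrightarrow>
    \<forall>i < p ^ N. D N a i = D N b i"
proof -
  define E where "E n = {(a, b) \<in> A \<times> A. \<forall>i < p ^ n. D n a i = D n b i}" for n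
  have sub: "E n \<subseteq> A \<times> A" for n by (auto simp: E_def)
  have fin: "finite (A \<times> A)" using finA by simp
  have E_Suc: "E n \<subseteq> E (Suc n)" for n
  proof -
    have "D (Suc n) a i = D (Suc n) b i"
      if "a \<in> A" "b \<in> A" "\<forall>i < p ^ n. D n a i = D n b i" "i < p ^ Suc n" for a b i
    proof -
      have "i div p ^ 1 < p ^ n"
        using that(4) by (intro less_mult_imp_div_less) (simp add: mult.commute)
      then show ?thesis using D_add[of a i 1 n] D_add[of b i 1 n] that by simp
    qed
    then show ?thesis unfolding E_def by auto
  qed
  \<comment> \<open>The relations E n increase inside the finite set A \<times> A, so one of maximal
    cardinality equals its successor.\<close>
  obtain N where N: "\<And>n. card (E n) \<le> card (E N)"
    using ex_has_greatest_nat[of "\<lambda>_. True" 0 "\<lambda>n. card (E n)" "Suc (card (A \<times> A))"]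
      card_mono[OF fin sub] by (auto simp: less_Suc_eq_le)
  have "E N = E (Suc N)"
    using N E_Suc by (intro card_seteq finite_subset[OF sub fin]) auto
  then show ?thesis
    by (intro that[of N]) (auto simp: E_def set_eq_iff)
qed

end

section \<open>Inverse systems of primitive substitutions\<close>

locale inverse_system =
  fixes p :: nat and A :: "nat \<Rightarrow> 'a set" and \<theta> :: "nat \<Rightarrow> 'a \<Rightarrow> 'a list" and a0 :: "nat \<Rightarrow> 'a"
    and \<phi> :: "nat \<Rightarrow> nat \<Rightarrow> 'a \<Rightarrow> 'a"
  assumes primitive_subst: "\<And>\<alpha>. primitive_subst p (A \<alpha>) (\<theta> \<alpha>) (a0 \<alpha>)"
    and \<phi>_in: "\<And>\<alpha> \<beta> a. \<alpha> \<le> \<beta> \<Longrightarrow> a \<in> A \<beta> \<Longrightarrow> \<phi> \<alpha> \<beta> a \<in> A \<alpha>"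
    and \<phi>_a0: "\<And>\<alpha> \<beta>. \<alpha> \<le> \<beta> \<Longrightarrow> \<phi> \<alpha> \<beta> (a0 \<beta>) = a0 \<alpha>"
    and \<phi>_\<theta>: "\<And>\<alpha> \<beta> a. \<alpha> \<le> \<beta> \<Longrightarrow> a \<in> A \<beta> \<Longrightarrow> map (\<phi> \<alpha> \<beta>) (\<theta> \<beta> a) = \<theta> \<alpha> (\<phi> \<alpha> \<beta> a)"
    and \<phi>_\<phi>: "\<And>\<alpha> \<beta> \<gamma> a. \<alpha> \<le> \<beta> \<Longrightarrow> \<beta> \<le> \<gamma> \<Longrightarrow> a \<in> A \<gamma> \<Longrightarrow> \<phi> \<alpha> \<beta> (\<phi> \<beta> \<gamma> a) = \<phi> \<alpha> \<gamma> a"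
    and periods: "\<And>N. \<exists>\<alpha>. \<forall>q. is_period (fixed_point (\<theta> \<alpha>) (a0 \<alpha>)) q \<longrightarrow> p ^ N dvd q"
begin

sublocale level: primitive_subst p "A \<alpha>" "\<theta> \<alpha>" "a0 \<alpha>" for \<alpha>
  by (rule primitive_subst)

abbreviation X where "X \<alpha> \<equiv> two_sided_shift (A \<alpha>) (\<theta> \<alpha>)"
abbreviation T where "T \<alpha> \<equiv> power_biinf p (\<theta> \<alpha>)"

section \<open>Projections between levels\<close>

lemma \<phi>_word:
  assumes "\<alpha> \<le> \<beta>" "set w \<subseteq> A \<beta>"
  shows "map (\<phi> \<alpha> \<beta>) ((apply_word (\<theta> \<beta>) ^^ n) w) = (apply_word (\<theta> \<alpha>) ^^ n) (map (\<phi> \<alpha> \<beta>) w)"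
proof (induction n)
  case (Suc n)
  have "map (\<phi> \<alpha> \<beta>) (apply_word (\<theta> \<beta>) v) = apply_word (\<theta> \<alpha>) (map (\<phi> \<alpha> \<beta>) v)"
    if "set v \<subseteq> A \<beta>" for v
    using that by (induction v) (auto simp: apply_word_def \<phi>_\<theta>[OF assms(1)])
  from this[OF level.word_power(1)[OF assms(2)]] show ?case using Suc by simp
qed simp

lemma \<phi>_power_letter:
  assumes "\<alpha> \<le> \<beta>" "a \<in> A \<beta>" "i < p ^ n"
  shows "\<phi> \<alpha> \<beta> (power_letter (\<theta> \<beta>) n a i) = power_letter (\<theta> \<alpha>) n (\<phi> \<alpha> \<beta> a) i"
  using \<phi>_word[of \<alpha> \<beta> "[a]" n] level.word_power_singleton(2)[OF assms(2), of n] assms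
  by (metis power_letter_def empty_subsetI insert_subset list.simps(15) list.set(1) list.simps(8,9) nth_map)

lemma \<phi>_T:
  assumes "\<alpha> \<le> \<beta>" "x \<in> X \<beta>"
  shows "\<phi> \<alpha> \<beta> \<circ> T \<beta> n x = T \<alpha> n (\<phi> \<alpha> \<beta> \<circ> x)"
proof
  fix j
  have "nat (j mod int (p ^ n)) < p ^ n"
    by (simp add: nat_less_iff del: of_nat_power)
  then show "(\<phi> \<alpha> \<beta> \<circ> T \<beta> n x) j = T \<alpha> n (\<phi> \<alpha> \<beta> \<circ> x) j"
    using \<phi>_power_letter[OF assms(1) level.X_in[OF assms(2)]] by (simp add: power_biinf_def)
qed

lemma comp_shift_by: "f \<circ> shift_by r x = shift_by r (f \<circ> x)"
  by (auto simp: shift_by_def)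

lemma \<phi>_X:
  assumes "\<alpha> \<le> \<beta>" "x \<in> X \<beta>"
  shows "\<phi> \<alpha> \<beta> \<circ> x \<in> X \<alpha>"
  unfolding level.X_iff
proof
  fix W
  obtain n a c where n: "a \<in> A \<beta>" "W \<le> c" "c + W < p ^ n"
    and x: "\<And>j. \<bar>j\<bar> \<le> int W \<Longrightarrow> x j = power_letter (\<theta> \<beta>) n a (nat (int c + j))"
    using level.X_window[OF assms(2)] by metis
  show "level.admissible \<alpha> (\<phi> \<alpha> \<beta> \<circ> x) W"
  proof (rule level.admissibleI[OF \<phi>_in[OF assms(1) n(1)] n(2,3)])
    fix j assume j: "\<bar>j\<bar> \<le> int W"
    then have "nat (int c + j) < p ^ n" using n by linarith
    then show "(\<phi> \<alpha> \<beta> \<circ> x) j = power_letter (\<theta> \<alpha>) n (\<phi> \<alpha> \<beta> a) (nat (int c + j))"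
      using x[OF j] \<phi>_power_letter[OF assms(1) n(1)] by simp
  qed
qed

lemma \<phi>_comp:
  assumes "\<alpha> \<le> \<beta>" "\<beta> \<le> \<gamma>" "x \<in> X \<gamma>"
  shows "\<phi> \<alpha> \<beta> \<circ> (\<phi> \<beta> \<gamma> \<circ> x) = \<phi> \<alpha> \<gamma> \<circ> x"
  using \<phi>_\<phi>[OF assms(1,2) level.X_in[OF assms(3)]] by auto

section \<open>Properties of all sufficiently high levels\<close>

lemma eventually_periods:
  obtains \<alpha> where "\<And>\<beta> q. \<alpha> \<le> \<beta> \<Longrightarrow> is_period (fixed_point (\<theta> \<beta>) (a0 \<beta>)) q \<Longrightarrow> p ^ N dvd q"
proof -
  obtain \<alpha> where \<alpha>: "\<And>q. is_period (fixed_point (\<theta> \<alpha>) (a0 \<alpha>)) q \<Longrightarrow> p ^ N dvd q"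
    using periods by blast
  \<comment> \<open>The fixed point at level \<beta> projects to the one at level \<alpha>, so its
    periods are periods at level \<alpha> and inherit the divisibility.\<close>
  have "is_period (fixed_point (\<theta> \<alpha>) (a0 \<alpha>)) q"
    if "\<alpha> \<le> \<beta>" "is_period (fixed_point (\<theta> \<beta>) (a0 \<beta>)) q" for \<beta> q
  proof -
    have "fixed_point (\<theta> \<alpha>) (a0 \<alpha>) n = \<phi> \<alpha> \<beta> (fixed_point (\<theta> \<beta>) (a0 \<beta>) n)" for n
      using \<phi>_power_letter[OF that(1) level.a0 level.less_p_power] \<phi>_a0[OF that(1)]
      by (simp add: fixed_point_def power_letter_def)
    then show ?thesis using that(2) by (simp add: is_period_def)
  qed
  then show ?thesis using that \<alpha> by blast
qed

lemma eventually_cutting_points_unique: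
  obtains \<alpha> where "\<And>\<beta> z z' k. \<alpha> \<le> \<beta> \<Longrightarrow> z \<in> X \<beta> \<Longrightarrow> z' \<in> X \<beta> \<Longrightarrow> T \<beta> n z = shift_by k (T \<beta> n z') \<Longrightarrow>
    int (p ^ n) dvd k"
proof -
  obtain \<alpha> where \<alpha>: "\<And>\<beta> q. \<alpha> \<le> \<beta> \<Longrightarrow> is_period (fixed_point (\<theta> \<beta>) (a0 \<beta>)) q \<Longrightarrow> p ^ n dvd q"
    using eventually_periods by blast
  show ?thesis
    by (rule that[of \<alpha>]) (rule level.cutting_points_unique; use \<alpha> in blast)
qed

text \<open>At level \<open>\<alpha>\<close> choose \<open>N\<close> such that \<open>\<theta>\<^sup>N\<^sup>+\<^sup>1\<close> identifies no more letters than \<open>\<theta>\<^sup>N\<close>. If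
  \<open>\<theta>(x) = \<theta>(x')\<close> at a level where the cutting points of order \<open>N + 1\<close> are unique, then \<open>x\<close> and
  \<open>x'\<close> are the same translate of \<open>\<theta>\<^sup>N(z)\<close> and \<open>\<theta>\<^sup>N(z')\<close>, and \<open>\<theta>\<^sup>N\<^sup>+\<^sup>1(z) = \<theta>\<^sup>N\<^sup>+\<^sup>1(z')\<close>.\<close>

lemma eventually_injective:
  obtains \<beta>\<^sub>0 where "\<alpha> \<le> \<beta>\<^sub>0" "\<And>\<beta> x x'. \<beta>\<^sub>0 \<le> \<beta> \<Longrightarrow> x \<in> X \<beta> \<Longrightarrow> x' \<in> X \<beta> \<Longrightarrow> T \<beta> 1 x = T \<beta> 1 x' \<Longrightarrow>
    \<phi> \<alpha> \<beta> \<circ> x = \<phi> \<alpha> \<beta> \<circ> x'"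
proof -
  obtain N where N: "\<And>a b. a \<in> A \<alpha> \<Longrightarrow> b \<in> A \<alpha> \<Longrightarrow>
      \<forall>i < p ^ Suc N. power_letter (\<theta> \<alpha>) (Suc N) a i = power_letter (\<theta> \<alpha>) (Suc N) b i \<Longrightarrow>
      \<forall>i < p ^ N. power_letter (\<theta> \<alpha>) N a i = power_letter (\<theta> \<alpha>) N b i"
    using level.powers_eq_stable[of \<alpha>] by metis
  obtain \<beta>\<^sub>1 where \<beta>\<^sub>1: "\<And>\<beta> z z' k. \<beta>\<^sub>1 \<le> \<beta> \<Longrightarrow> z \<in> X \<beta> \<Longrightarrow> z' \<in> X \<beta> \<Longrightarrow>
      T \<beta> (Suc N) z = shift_by k (T \<beta> (Suc N) z') \<Longrightarrow> int (p ^ Suc N) dvd k"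
    using eventually_cutting_points_unique[of "Suc N"] by blast
  show ?thesis
  proof (rule that[of "max \<alpha> \<beta>\<^sub>1"])
    fix \<beta> x x'
    assume \<beta>: "max \<alpha> \<beta>\<^sub>1 \<le> \<beta>" and x: "x \<in> X \<beta>" "x' \<in> X \<beta>" and eq: "T \<beta> 1 x = T \<beta> 1 x'"
    have \<alpha>\<beta>: "\<alpha> \<le> \<beta>" "\<beta>\<^sub>1 \<le> \<beta>" using \<beta> by auto
    obtain k z where z: "k < p ^ N" "z \<in> X \<beta>" "x = shift_by (int k) (T \<beta> N z)"
      using level.desubstitute[OF x(1)] by blast
    obtain k' z' where z': "k' < p ^ N" "z' \<in> X \<beta>" "x' = shift_by (int k') (T \<beta> N z')"
      using level.desubstitute[OF x(2)] by blast
    \<comment> \<open>Applying \<theta> once more multiplies the offsets k and k' by p. Uniqueness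
      of the cutting points of order N + 1 then makes p^N divide k' - k, and both offsets are below
      p^N.\<close>
    have T1: "T \<beta> 1 (shift_by k (T \<beta> N z)) = shift_by (k * int p) (T \<beta> (Suc N) z)" if "z \<in> X \<beta>" for k z
      using level.T_add[OF that, of 1 N] by (simp add: level.T_shift_by)
    have eq': "T \<beta> (Suc N) z = shift_by ((int k' - int k) * int p) (T \<beta> (Suc N) z')"
    proof -
      have "shift_by (int k * int p) (T \<beta> (Suc N) z) = shift_by (int k' * int p) (T \<beta> (Suc N) z')"
        using eq unfolding z(3) z'(3) T1[OF z(2)] T1[OF z'(2)] .
      then show ?thesis by (simp add: shift_by_eq_shift_by_iff left_diff_distrib)
    qed
    have "int (p ^ Suc N) dvd (int k' - int k) * int p"
      by (rule \<beta>\<^sub>1[OF \<alpha>\<beta>(2) z(2) z'(2) eq'])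
    then have "int (p ^ N) dvd int k' - int k"
      using level.p_gt_1 by (simp add: mult.commute)
    then have "k = k'"
      using z(1) z'(1) by (rule dvd_diff_imp_eq)
    have TSuc: "T \<alpha> (Suc N) (\<phi> \<alpha> \<beta> \<circ> z) = T \<alpha> (Suc N) (\<phi> \<alpha> \<beta> \<circ> z')"
      using eq' \<open>k = k'\<close> \<phi>_T[OF \<alpha>\<beta>(1) z(2), of "Suc N"] \<phi>_T[OF \<alpha>\<beta>(1) z'(2), of "Suc N"] by simp
    have "T \<alpha> N (\<phi> \<alpha> \<beta> \<circ> z) = T \<alpha> N (\<phi> \<alpha> \<beta> \<circ> z')"
    proof
      fix j
      define l where "l = j div int (p ^ N)"
      let ?a = "(\<phi> \<alpha> \<beta> \<circ> z) l" and ?b = "(\<phi> \<alpha> \<beta> \<circ> z') l"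
      \<comment> \<open>Block l of the common image under \<theta>^(N+1) consists of the image of ?a
        and also of that of ?b; the choice of N then removes one power.\<close>
      have "power_letter (\<theta> \<alpha>) (Suc N) ?a i = power_letter (\<theta> \<alpha>) (Suc N) ?b i" if "i < p ^ Suc N" for i
      proof -
        have "(l * int (p ^ Suc N) + int i) div int (p ^ Suc N) = l"
          "nat ((l * int (p ^ Suc N) + int i) mod int (p ^ Suc N)) = i"
          using that by (simp_all only: div_mult_self3 mod_mult_self3 of_nat_less_iff zmod_int[symmetric]
              zdiv_int[symmetric] mod_less div_less nat_int)
        then show ?thesis
          using fun_cong[OF TSuc, of "l * int (p ^ Suc N) + int i"]
          by (simp only: power_biinf_def)
      qed
      then have "\<forall>i < p ^ N. power_letter (\<theta> \<alpha>) N ?a i = power_letter (\<theta> \<alpha>) N ?b i"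
        by (intro N level.X_in \<phi>_X[OF \<alpha>\<beta>(1)] z z') blast
      moreover have "nat (j mod int (p ^ N)) < p ^ N"
        by (simp add: nat_less_iff del: of_nat_power)
      ultimately show "T \<alpha> N (\<phi> \<alpha> \<beta> \<circ> z) j = T \<alpha> N (\<phi> \<alpha> \<beta> \<circ> z') j"
        by (simp add: power_biinf_def l_def)
    qed
    then show "\<phi> \<alpha> \<beta> \<circ> x = \<phi> \<alpha> \<beta> \<circ> x'"
      by (simp add: z z' \<open>k = k'\<close> comp_shift_by \<phi>_T[OF \<alpha>\<beta>(1)])
  qed simp
qed

section \<open>Desubstitution in the inverse limit\<close>

definition limit_shift :: "(nat \<Rightarrow> int \<Rightarrow> 'a) set" where
  "limit_shift = {x. (\<forall>\<alpha>. x \<alpha> \<in> X \<alpha>) \<and> (\<forall>\<alpha> \<beta>. \<alpha> \<le> \<beta> \<longrightarrow> \<phi> \<alpha> \<beta> \<circ> x \<beta> = x \<alpha>)}"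

text \<open>The preimages \<open>f \<alpha>\<close> chosen level by level need not be compatible.
  Projected to level \<alpha>, however, those from sufficiently high levels coincide by
  \<open>eventually_injective\<close>, and these stable projections form a point of the
  limit.\<close>

lemma limit_desubstitute:
  assumes y: "y \<in> limit_shift"
  shows "\<exists>x\<in>limit_shift. \<exists>k<p. \<forall>\<alpha>. y \<alpha> = shift_by (int k) (T \<alpha> 1 (x \<alpha>))"
proof -
  have yX: "y \<alpha> \<in> X \<alpha>" and y\<phi>: "\<alpha> \<le> \<beta> \<Longrightarrow> \<phi> \<alpha> \<beta> \<circ> y \<beta> = y \<alpha>" for \<alpha> \<beta>
    using y by (auto simp: limit_shift_def)
  have "\<exists>k x. k < p \<and> x \<in> X \<alpha> \<and> y \<alpha> = shift_by (int k) (T \<alpha> 1 x)" for \<alpha>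
    using level.desubstitute[OF yX[of \<alpha>], where n = 1] by auto
  then obtain \<kappa> f where f: "\<And>\<alpha>. \<kappa> \<alpha> < p" "\<And>\<alpha>. f \<alpha> \<in> X \<alpha>"
    "\<And>\<alpha>. y \<alpha> = shift_by (int (\<kappa> \<alpha>)) (T \<alpha> 1 (f \<alpha>))"
    by metis
  have f_proj: "\<phi> \<alpha> \<beta> \<circ> f \<beta> \<in> X \<alpha>" "y \<alpha> = shift_by (int (\<kappa> \<beta>)) (T \<alpha> 1 (\<phi> \<alpha> \<beta> \<circ> f \<beta>))"
    if "\<alpha> \<le> \<beta>" for \<alpha> \<beta>
    using \<phi>_X[OF that f(2)] y\<phi>[OF that] f(3)[of \<beta>] \<phi>_T[OF that f(2), of 1]
    by (simp_all add: comp_shift_by)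
  obtain \<beta>\<^sub>1 where \<beta>\<^sub>1: "\<And>\<beta> z z' k. \<beta>\<^sub>1 \<le> \<beta> \<Longrightarrow> z \<in> X \<beta> \<Longrightarrow> z' \<in> X \<beta> \<Longrightarrow>
      T \<beta> 1 z = shift_by k (T \<beta> 1 z') \<Longrightarrow> int (p ^ 1) dvd k"
    using eventually_cutting_points_unique[of 1] by blast
  \<comment> \<open>Projecting a preimage from a higher level \<beta> gives another desubstitution
    of \<open>y \<beta>\<^sub>1\<close>, with phase \<open>\<kappa> \<beta>\<close>. Uniqueness at
    level \<open>\<beta>\<^sub>1\<close> thus fixes the phase from there on.\<close>
  define k where "k = \<kappa> \<beta>\<^sub>1"
  have \<kappa>: "\<kappa> \<beta> = k" if "\<beta>\<^sub>1 \<le> \<beta>" for \<beta>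
  proof -
    have "T \<beta>\<^sub>1 1 (f \<beta>\<^sub>1) = shift_by (- int k) (y \<beta>\<^sub>1)"
      using f(3)[of \<beta>\<^sub>1] by (simp add: k_def)
    also have "\<dots> = shift_by (- int k + int (\<kappa> \<beta>)) (T \<beta>\<^sub>1 1 (\<phi> \<beta>\<^sub>1 \<beta> \<circ> f \<beta>))"
      by (subst f_proj(2)[OF that]) simp
    finally have "int (p ^ 1) dvd - int k + int (\<kappa> \<beta>)"
      by (rule \<beta>\<^sub>1[OF order_refl f(2) f_proj(1)[OF that]])
    then show ?thesis using f(1) dvd_diff_imp_eq[of p "\<kappa> \<beta>" k] by (simp add: k_def)
  qed
  have "\<exists>\<beta>\<^sub>0\<ge>\<alpha>. \<forall>\<beta> x x'. \<beta>\<^sub>0 \<le> \<beta> \<longrightarrow> x \<in> X \<beta> \<longrightarrow> x' \<in> X \<beta> \<longrightarrow> T \<beta> 1 x = T \<beta> 1 x' \<longrightarrow>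
      \<phi> \<alpha> \<beta> \<circ> x = \<phi> \<alpha> \<beta> \<circ> x'" for \<alpha>
    using eventually_injective[of \<alpha>] by metis
  then obtain B where B: "\<And>\<alpha>. \<alpha> \<le> B \<alpha>" "\<And>\<alpha> \<beta> x x'. B \<alpha> \<le> \<beta> \<Longrightarrow> x \<in> X \<beta> \<Longrightarrow> x' \<in> X \<beta> \<Longrightarrow>
      T \<beta> 1 x = T \<beta> 1 x' \<Longrightarrow> \<phi> \<alpha> \<beta> \<circ> x = \<phi> \<alpha> \<beta> \<circ> x'"
    by metis
  \<comment> \<open>From this level on the phase is k and equal images force equal projections to
    level \<alpha>.\<close>
  define C where "C \<alpha> = max \<beta>\<^sub>1 (B \<alpha>)" for \<alpha>
  define x where "x \<alpha> = \<phi> \<alpha> (C \<alpha>) \<circ> f (C \<alpha>)" for \<alpha>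
  have C: "\<alpha> \<le> C \<alpha>" "\<beta>\<^sub>1 \<le> C \<alpha>" "B \<alpha> \<le> C \<alpha>" for \<alpha>
    using B(1)[of \<alpha>] by (auto simp: C_def)
  have x_eq: "\<phi> \<alpha> \<beta> \<circ> f \<beta> = x \<alpha>" if "C \<alpha> \<le> \<beta>" for \<alpha> \<beta>
  proof -
    have "\<beta>\<^sub>1 \<le> \<beta>" using that C(2) order_trans by blast
    then have "shift_by (int k) (T (C \<alpha>) 1 (f (C \<alpha>))) = shift_by (int k) (T (C \<alpha>) 1 (\<phi> (C \<alpha>) \<beta> \<circ> f \<beta>))"
      using f(3)[of "C \<alpha>"] f_proj(2)[OF that] \<kappa> C by simp
    then have "T (C \<alpha>) 1 (f (C \<alpha>)) = T (C \<alpha>) 1 (\<phi> (C \<alpha>) \<beta> \<circ> f \<beta>)"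
      by (simp add: shift_by_eq_shift_by_iff)
    then have "\<phi> \<alpha> (C \<alpha>) \<circ> f (C \<alpha>) = \<phi> \<alpha> (C \<alpha>) \<circ> (\<phi> (C \<alpha>) \<beta> \<circ> f \<beta>)"
      by (rule B(2)[OF C(3) f(2) f_proj(1)[OF that]])
    then show ?thesis unfolding x_def using \<phi>_comp[OF C(1) that f(2)] by simp
  qed
  show ?thesis
  proof (intro bexI[of _ x] exI[of _ k] conjI allI)
    show "k < p" using f(1) by (simp add: k_def)
    show "y \<alpha> = shift_by (int k) (T \<alpha> 1 (x \<alpha>))" for \<alpha>
      unfolding x_def using f_proj(2)[OF C(1)] \<kappa>[OF C(2)] by metis
    show "x \<in> limit_shift"
      unfolding limit_shift_def
    proof (intro CollectI conjI allI impI)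
      show "x \<alpha> \<in> X \<alpha>" for \<alpha> unfolding x_def by (rule f_proj(1)[OF C(1)])
      fix \<alpha> \<beta> :: nat assume "\<alpha> \<le> \<beta>"
      define \<gamma> where "\<gamma> = max (C \<alpha>) (C \<beta>)"
      have "\<beta> \<le> \<gamma>" using C(1)[of \<beta>] by (simp add: \<gamma>_def)
      have "\<phi> \<alpha> \<beta> \<circ> x \<beta> = \<phi> \<alpha> \<beta> \<circ> (\<phi> \<beta> \<gamma> \<circ> f \<gamma>)"
        using x_eq[of \<beta> \<gamma>] by (simp add: \<gamma>_def)
      also have "\<dots> = x \<alpha>"
        using \<phi>_comp[OF \<open>\<alpha> \<le> \<beta>\<close> \<open>\<beta> \<le> \<gamma>\<close> f(2)] x_eq[of \<alpha> \<gamma>] by (simp add: \<gamma>_def)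
      finally show "\<phi> \<alpha> \<beta> \<circ> x \<beta> = x \<alpha>" .
    qed
  qed
qed

text \<open>One high level determines the phase. The images then agree at every level, and equality
  at level \<alpha> follows by projecting from a level where \<open>eventually_injective\<close>
  applies.\<close>

lemma limit_desubstitute_unique:
  assumes x: "x \<in> limit_shift" "x' \<in> limit_shift" and k: "k < p" "k' < p"
    and eq: "\<And>\<alpha>. shift_by (int k) (T \<alpha> 1 (x \<alpha>)) = shift_by (int k') (T \<alpha> 1 (x' \<alpha>))"
  shows "x = x'" "k = k'"
proof -
  have X: "x \<alpha> \<in> X \<alpha>" "x' \<alpha> \<in> X \<alpha>" for \<alpha>
    using x by (auto simp: limit_shift_def)
  obtain \<beta>\<^sub>1 where \<beta>\<^sub>1: "\<And>\<beta> z z' k. \<beta>\<^sub>1 \<le> \<beta> \<Longrightarrow> z \<in> X \<beta> \<Longrightarrow> z' \<in> X \<beta> \<Longrightarrow>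
      T \<beta> 1 z = shift_by k (T \<beta> 1 z') \<Longrightarrow> int (p ^ 1) dvd k"
    using eventually_cutting_points_unique[of 1] by blast
  have "T \<beta>\<^sub>1 1 (x \<beta>\<^sub>1) = shift_by (int k' - int k) (T \<beta>\<^sub>1 1 (x' \<beta>\<^sub>1))"
    using eq[of \<beta>\<^sub>1] by (simp add: shift_by_eq_shift_by_iff)
  from \<beta>\<^sub>1[OF order_refl X this] have "int p dvd int k' - int k" by simp
  then show "k = k'" using k by (rule dvd_diff_imp_eq)
  with eq have T_eq: "T \<alpha> 1 (x \<alpha>) = T \<alpha> 1 (x' \<alpha>)" for \<alpha>
    by (simp add: shift_by_eq_shift_by_iff)
  show "x = x'"
  proof
    fix \<alpha>
    obtain \<beta> where \<beta>: "\<alpha> \<le> \<beta>" "\<And>x x'. x \<in> X \<beta> \<Longrightarrow> x' \<in> X \<beta> \<Longrightarrow> T \<beta> 1 x = T \<beta> 1 x' \<Longrightarrow>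
        \<phi> \<alpha> \<beta> \<circ> x = \<phi> \<alpha> \<beta> \<circ> x'"
      using eventually_injective[of \<alpha>] by (metis order_refl)
    from \<beta>(2)[OF X T_eq] show "x \<alpha> = x' \<alpha>"
      using x \<beta>(1) by (simp add: limit_shift_def)
  qed
qed

end

section \<open>Recognizability\<close>

text \<open>No power of the substitution produces \<open>Fresh\<close> from a state, so primitivity excludes it.\<close>

lemma start_letter_eq:
  assumes M: "init M \<in> states M" "\<forall>s\<in>states M. \<forall>i<p. trans M s i \<in> states M"
    and prim: "primitive (alphabet M) (aut_subst p M)"
  shows "trans M (init M) 0 = init M"
proof (rule ccontr)
  assume "\<not> ?thesis"
  then have "Fresh \<in> alphabet M" by (simp add: alphabet_def start_letter_def)
  then obtain k where "Fresh \<in> set ((apply_word (aut_subst p M) ^^ k) [State (init M)])"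
    using prim M(1) by (auto simp: primitive_def alphabet_def)
  moreover have "set ((apply_word (aut_subst p M) ^^ k) [State (init M)]) \<subseteq> State ` states M" for k
  proof (induction k)
    case (Suc k)
    have "set (aut_subst p M (State s)) \<subseteq> State ` states M" if "s \<in> states M" for s
      using M(2) that by auto
    then show ?case using Suc by (fastforce simp: apply_word_def)
  qed (use M in auto)
  ultimately show False by blast
qed

theorem theorem4p9:
  fixes p :: nat
    and M :: "nat \<Rightarrow> 'q automaton"
    and \<psi> :: "nat \<Rightarrow> nat \<Rightarrow> 'q \<Rightarrow> 'q"
  assumes "prime p"
    and "inverse_family p M \<psi>"
    and "\<And>\<alpha>. const_length p (alphabet (M \<alpha>)) (aut_subst p (M \<alpha>))"
    and "\<And>\<alpha>. primitive (alphabet (M \<alpha>)) (aut_subst p (M \<alpha>))"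
    and "unbounded_p_periods p M"
  shows "recognizable p (profinite_shift p M \<psi>) (profinite_subst p M)"
proof -
  have p: "p > 0" using assms(1) prime_gt_0_nat by blast
  have M: "finite (states (M \<alpha>))" "init (M \<alpha>) \<in> states (M \<alpha>)"
    "\<forall>s\<in>states (M \<alpha>). \<forall>i<p. trans (M \<alpha>) s i \<in> states (M \<alpha>)" for \<alpha>
    using assms(2) by (auto simp: inverse_family_def automaton_mod_def)
  have fix0: "trans (M \<alpha>) (init (M \<alpha>)) 0 = init (M \<alpha>)" for \<alpha>
    by (rule start_letter_eq[OF M(2,3) assms(4)])
  have start: "start_letter (M \<alpha>) = State (init (M \<alpha>))" for \<alpha>
    using fix0 by (simp add: start_letter_def)
  have alph: "alphabet (M \<alpha>) = State ` states (M \<alpha>)" for \<alpha>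
    using M(2) by (auto simp: alphabet_def start)
  \<comment> \<open>With \<open>Fresh\<close> excluded every letter is a \<open>State\<close>, so
    \<open>letter_map\<close> reduces to \<psi> and the conditions on \<phi> come from
    \<open>inverse_family\<close>.\<close>
  interpret inverse_system p "\<lambda>\<alpha>. alphabet (M \<alpha>)" "\<lambda>\<alpha>. aut_subst p (M \<alpha>)"
    "\<lambda>\<alpha>. start_letter (M \<alpha>)" "letter_map M \<psi>"
  proof (rule inverse_system.intro)
    show "primitive_subst p (alphabet (M \<alpha>)) (aut_subst p (M \<alpha>)) (start_letter (M \<alpha>))" for \<alpha>
    proof
      show "set (aut_subst p (M \<alpha>) a) \<subseteq> alphabet (M \<alpha>)" if "a \<in> alphabet (M \<alpha>)" for a
        using that M(3) by (auto simp: alph)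
    qed (use assms(1,3,4) M p fix0 in \<open>auto simp: alph start\<close>)
    fix \<alpha> \<beta> :: nat
    assume "\<alpha> \<le> \<beta>"
    then have \<psi>: "\<psi> \<alpha> \<beta> ` states (M \<beta>) \<subseteq> states (M \<alpha>)" "\<psi> \<alpha> \<beta> (init (M \<beta>)) = init (M \<alpha>)"
      "\<forall>s\<in>states (M \<beta>). \<forall>i<p. \<psi> \<alpha> \<beta> (trans (M \<beta>) s i) = trans (M \<alpha>) (\<psi> \<alpha> \<beta> s) i"
      using assms(2) unfolding inverse_family_def by blast+
    show "letter_map M \<psi> \<alpha> \<beta> (start_letter (M \<beta>)) = start_letter (M \<alpha>)"
      using \<psi> by (simp add: start)
    fix a assume "a \<in> alphabet (M \<beta>)"
    then obtain s where s: "a = State s" "s \<in> states (M \<beta>)" by (auto simp: alph)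
    show "letter_map M \<psi> \<alpha> \<beta> a \<in> alphabet (M \<alpha>)"
      using \<psi> s by (auto simp: alph)
    show "map (letter_map M \<psi> \<alpha> \<beta>) (aut_subst p (M \<beta>) a) = aut_subst p (M \<alpha>) (letter_map M \<psi> \<alpha> \<beta> a)"
      using \<psi> s by auto
  next
    fix \<alpha> \<beta> \<gamma> :: nat and a assume le: "\<alpha> \<le> \<beta>" "\<beta> \<le> \<gamma>" and "a \<in> alphabet (M \<gamma>)"
    then obtain s where s: "a = State s" "s \<in> states (M \<gamma>)" by (auto simp: alph)
    then have "\<psi> \<alpha> \<gamma> s = \<psi> \<alpha> \<beta> (\<psi> \<beta> \<gamma> s)"
      using assms(2) le unfolding inverse_family_def by blast
    then show "letter_map M \<psi> \<alpha> \<beta> (letter_map M \<psi> \<beta> \<gamma> a) = letter_map M \<psi> \<alpha> \<gamma> a"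
      using s by simp
  next
    show "\<exists>\<alpha>. \<forall>q. is_period (fixed_point (aut_subst p (M \<alpha>)) (start_letter (M \<alpha>))) q \<longrightarrow> p ^ N dvd q" for N
      using assms(5) by (simp add: unbounded_p_periods_def aut_fixed_point_def)
  qed
  \<comment> \<open>\<open>profinite_shift\<close> consists of sequences of families,
    \<open>limit_shift\<close> of families of sequences; ?t exchanges the two arguments.\<close>
  let ?t = "\<lambda>x \<alpha> n. x n \<alpha>"
  have mem: "x \<in> profinite_shift p M \<psi> \<longleftrightarrow> ?t x \<in> limit_shift" for x
    by (auto simp: profinite_shift_def limit_shift_def aut_shift_def fun_eq_iff)
  have biinf: "apply_biinf p (profinite_subst p M) x n \<alpha> = T \<alpha> 1 (?t x \<alpha>) n" for x n \<alpha>
  proof -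
    have "nat (n mod int p) < p" using p by (simp add: nat_less_iff)
    then show ?thesis
      by (simp only: power_biinf_1) (simp add: apply_biinf_def profinite_subst_def)
  qed
  have eq: "y = (shift ^^ k) (apply_biinf p (profinite_subst p M) x) \<longleftrightarrow>
      (\<forall>\<alpha>. ?t y \<alpha> = shift_by (int k) (T \<alpha> 1 (?t x \<alpha>)))" for x y k
    by (auto simp: funpow_shift fun_eq_iff shift_by_def biinf)
  have len: "length (profinite_subst p M s) = p" for s
    by (simp add: profinite_subst_def)
  show ?thesis
    unfolding recognizable_def len eq mem
  proof
    fix y assume "y \<in> profinite_shift p M \<psi>"
    then obtain x k where x: "x \<in> limit_shift" "k < p" "\<forall>\<alpha>. ?t y \<alpha> = shift_by (int k) (T \<alpha> 1 (x \<alpha>))"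
      using limit_desubstitute[of "?t y"] mem by blast
    show "\<exists>!(x, k). ?t x \<in> limit_shift \<and> k < p \<and> (\<forall>\<alpha>. ?t y \<alpha> = shift_by (int k) (T \<alpha> 1 (?t x \<alpha>)))"
    proof (rule ex1I[of _ "(\<lambda>n \<alpha>. x \<alpha> n, k)"])
      fix xk assume "case xk of (x, k) \<Rightarrow> ?t x \<in> limit_shift \<and> k < p \<and>
          (\<forall>\<alpha>. ?t y \<alpha> = shift_by (int k) (T \<alpha> 1 (?t x \<alpha>)))"
      then obtain x' k' where x': "xk = (x', k')" "?t x' \<in> limit_shift" "k' < p"
        "\<forall>\<alpha>. ?t y \<alpha> = shift_by (int k') (T \<alpha> 1 (?t x' \<alpha>))"
        by (cases xk) auto
      have "?t x' = x \<and> k' = k"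
        using limit_desubstitute_unique[OF x'(2) x(1) x'(3) x(2)] x(3) x'(4) by metis
      then show "xk = (\<lambda>n \<alpha>. x \<alpha> n, k)" using x'(1) by auto
    qed (use x in simp)
  qed
qed

end
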